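(* For every integer $m\ge2$, let $f_m\colon\mathrm{SU}(1,1)\to\mathrm{SU}(1,1)$ be the smooth map defined in the context, and let $$s_m(q)=\left(qf_m(q),\bigl(f_m(q)^{-1}\bigr)^\dagger\right),\qquad q\in\mathrm{SU}(1,1).$$ Then $s_m$ is an $\Omega$-Lagrangian section (i.e. $s_m^*\Omega=0$) of the principal spin bundle $P=\mathrm{SU}(1,1)\times\mathrm{SU}(1,1)$ over $\mathrm{AdS}_3=\mathrm{SU}(1,1)$.
   Context: Algebra (Lorentzian case). $\mathfrak m=(\mathbb R^{1,2},\langle\cdot,\cdot\rangle)$ is oriented with oriented orthonormal basis $X_0,X_1,X_2$, $\langle X_0,X_0\rangle=-1$, $\langle X_1,X_1\rangle=\langle X_2,X_2\rangle=1$; $H=\mathrm{SU}(1,1)$ with Lie algebra $\mathfrak h$. $\gamma_0=\mathrm{diag}(1,-1)$, $\gamma_1=\begin{pmatrix}0&1\\-1&0\end{pmatrix}$, $\gamma_2=\begin{pmatrix}0&\sqrt{-1}\\ \sqrt{-1}&0\end{pmatrix}$; $\gamma\colon\mathfrak m\to\mathfrak{gl}(2,\mathbb C)$ is linear with $\gamma(X_k)=\gamma_k$. $l_g\colon\mathfrak m\to\mathfrak h$ is the linear isomorphism $l_g(X)=\frac{\sqrt{-1}}2\gamma(X)$. Space. $\mathrm{AdS}_3=H$ carries the bi-invariant metric $g$ of constant sectional curvature $-1$: $g_q(2q\,l_g(X),2q\,l_g(Y))=\langle X,Y\rangle$. Its principal spin bundle is $P=H\times H$ with $\pi(g_L,g_R)=g_Lg_R^\dagger$,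 right $H$-action $(g_L,g_R)\cdot h=(g_Lh,g_R(h^{-1})^\dagger)$, solder form $\theta=l_g^{-1}\frac{\omega^L+(\omega^R)^\dagger}{2}$ and spin Levi-Civita connection form $\widetilde\omega=\frac{\omega^L-(\omega^R)^\dagger}{2}$, where $\omega^L,\omega^R$ are the (left-invariant) Maurer–Cartan forms of the factors. Two-form. For $X\in\mathfrak m$, $X^H$ is the vector field on $P$ with $\theta(X^H)=X$, $\widetilde\omega(X^H)=0$; for $U\in\mathfrak h$, $U^\#$ is the fundamental vector field ($\widetilde\omega(U^\#)=U$, $\theta(U^\#)=0$). $\Omega$ is the two-form on $P$ with $\Omega(X^H+U^\#,Y^H+V^\#)=\langle X,l_g^{-1}V\rangle-\langle l_g^{-1}U,Y\rangle$. Construction of $f_m$. Put $\ell=X_1-X_0$, $\omega_m=\sqrt{2/(m^2-1)}$, $Y_m=-\frac{\omega_m^2+11}{6}X_0+\frac{\omega_m^2-7}{6}X_1$, $Z_m=-\frac{\omega_m^2+9}{6}X_0+\frac{\omega_m^2-9}{6}X_1$, $T_m=2\pi/\omega_m$. For $u,w,v\in\mathbb R$ let $a(u,w)=\exp(u\,l_g(\ell))\exp(-2w\,l_g(X_2))$, $b_m(v)=\exp(2v\,l_g(Y_m))$, $k_m(v)=\exp(2v\,l_g(Z_m))$ in $\mathrm{SU}(1,1)$. Both $b_m$ and $k_m$ are $T_m$-periodic, and $\mathbb R^2\times\mathbb R/T_m\mathbb Z\ni(w,u,[v])\mapsto a(u,w)k_m(v)^{-1}\in\mathrm{SU}(1,1)$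 is a diffeomorphism. Writing $q=a(u,w)k_m(v)^{-1}$, define $f_m(q)=k_m(v)b_m(v)^{-1}$. *)

theory Defs
  imports "HOL-Analysis.Analysis"
begin

section \<open>Smooth maps and tangent spaces of subsets of Euclidean spaces\<close>

text \<open>
  \<open>Ck_on k U f\<close> is only meant for open \<open>U\<close> in a finite-dimensional domain: there, being \<open>k\<close> times
  continuously differentiable is the same as having all iterated directional derivatives of order
  at most \<open>k\<close> exist (with \<open>f\<close> differentiable at every stage) and be continuous.
\<close>

primrec Ck_on ::
  "nat \<Rightarrow> 'a::euclidean_space set \<Rightarrow> ('a \<Rightarrow> 'b::real_normed_vector) \<Rightarrow> bool" where
  "Ck_on 0 U f \<longleftrightarrow> continuous_on U f"
| "Ck_on (Suc k) U f \<longleftrightarrow>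
     (\<forall>x\<in>U. f differentiable at x) \<and> (\<forall>v. Ck_on k U (\<lambda>x. frechet_derivative f (at x) v))"

definition smooth_on :: "'a::euclidean_space set \<Rightarrow> ('a \<Rightarrow> 'b::real_normed_vector) \<Rightarrow> bool" where
  "smooth_on U f \<longleftrightarrow> (\<forall>k. Ck_on k U f)"

text \<open>For a map on an embedded submanifold \<open>M\<close>, smoothness means having local smooth extensions.\<close>

definition smooth_map :: "'a::euclidean_space set \<Rightarrow> ('a \<Rightarrow> 'b::real_normed_vector) \<Rightarrow> bool" where
  "smooth_map M f \<longleftrightarrow>
     (\<forall>x\<in>M. \<exists>U F. open U \<and> x \<in> U \<and> smooth_on U F \<and> (\<forall>y\<in>M \<inter> U. F y = f y))"

definition tangent_space :: "'a::euclidean_space set \<Rightarrow> 'a \<Rightarrow> 'a set" where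
  "tangent_space M x =
     {v. \<exists>c e. e > 0 \<and> smooth_on {-e<..<e} c \<and> c ` {-e<..<e} \<subseteq> M \<and> c 0 = x \<and>
            (c has_vector_derivative v) (at (0::real))}"

text \<open>
  The derivative of \<open>f\<close> at \<open>x\<close> within \<open>M\<close> is not unique as a linear map on the ambient space, but
  all choices agree on \<open>tangent_space M x\<close>, by the chain rule along curves in \<open>M\<close>.
  Pullbacks of forms are only to be evaluated there.
\<close>

definition differential ::
  "'a::euclidean_space set \<Rightarrow> ('a \<Rightarrow> 'b::real_normed_vector) \<Rightarrow> 'a \<Rightarrow> 'a \<Rightarrow> 'b" where
  "differential M f x = frechet_derivative f (at x within M)"

definition pullback2 ::
  "'a::euclidean_space set \<Rightarrow> ('a \<Rightarrow> 'b::real_normed_vector) \<Rightarrow> ('b \<Rightarrow> 'b \<Rightarrow> 'b \<Rightarrow> real) \<Rightarrow>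
    'a \<Rightarrow> 'a \<Rightarrow> 'a \<Rightarrow> real" where
  "pullback2 M f \<alpha> x v w = \<alpha> (f x) (differential M f x v) (differential M f x w)"


section \<open>The group SU(1,1), its Lie algebra, and the exponential map\<close>

type_synonym cmat2 = "complex^2^2"

definition mk_mat2 :: "complex \<Rightarrow> complex \<Rightarrow> complex \<Rightarrow> complex \<Rightarrow> cmat2" where
  "mk_mat2 a b c d = vector [vector [a, b], vector [c, d]]"

definition dagger :: "cmat2 \<Rightarrow> cmat2" where
  "dagger A = (\<chi> i j. cnj (A $ j $ i))"

definition J11 :: cmat2 where
  "J11 = mk_mat2 1 0 0 (-1)"

definition SU11 :: "cmat2 set" where
  "SU11 = {A. dagger A ** J11 ** A = J11 \<and> det A = 1}"

definition su11 :: "cmat2 set" where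
  "su11 = {A. dagger A ** J11 + J11 ** A = 0 \<and> trace A = 0}"

primrec mat_pow :: "cmat2 \<Rightarrow> nat \<Rightarrow> cmat2" where
  "mat_pow A 0 = mat 1"
| "mat_pow A (Suc n) = A ** mat_pow A n"

definition mat_exp :: "cmat2 \<Rightarrow> cmat2" where
  "mat_exp A = (\<Sum>n. (1 / fact n) *\<^sub>R mat_pow A n)"


section \<open>Minkowski space and the isomorphism with the Lie algebra\<close>

text \<open>
  Minkowski space is \<open>real^3\<close>, indexed by \<open>0, 1, 2 :: 3\<close>; in this index type \<open>0 = 3\<close>, so that
  the time component \<open>X $ 0\<close> is also \<open>X $ 3\<close>.
\<close>

type_synonym mink = "real^3"

definition mink_inner :: "mink \<Rightarrow> mink \<Rightarrow> real" where
  "mink_inner X Y = - (X $ 0) * (Y $ 0) + (X $ 1) * (Y $ 1) + (X $ 2) * (Y $ 2)"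

definition X0 :: mink where "X0 = axis 0 1"
definition X1 :: mink where "X1 = axis 1 1"
definition X2 :: mink where "X2 = axis 2 1"

definition gamma0 :: cmat2 where "gamma0 = mk_mat2 1 0 0 (-1)"
definition gamma1 :: cmat2 where "gamma1 = mk_mat2 0 1 (-1) 0"
definition gamma2 :: cmat2 where "gamma2 = mk_mat2 0 \<i> \<i> 0"

definition gamma :: "mink \<Rightarrow> cmat2" where
  "gamma X = (X $ 0) *\<^sub>R gamma0 + (X $ 1) *\<^sub>R gamma1 + (X $ 2) *\<^sub>R gamma2"

definition lg :: "mink \<Rightarrow> cmat2" where
  "lg X = mat (\<i> / 2) ** gamma X"

definition lg_inv :: "cmat2 \<Rightarrow> mink" where
  "lg_inv = inv_into UNIV lg"


section \<open>The principal spin bundle of anti-de Sitter space and its two-form\<close>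

definition spin_bundle :: "(cmat2 \<times> cmat2) set" where
  "spin_bundle = SU11 \<times> SU11"

definition bundle_proj :: "cmat2 \<times> cmat2 \<Rightarrow> cmat2" where
  "bundle_proj p = fst p ** dagger (snd p)"

text \<open>Differential forms on the bundle take a base point and tangent vectors at that point.\<close>

definition omega_L :: "cmat2 \<times> cmat2 \<Rightarrow> cmat2 \<times> cmat2 \<Rightarrow> cmat2" where
  "omega_L p \<xi> = matrix_inv (fst p) ** fst \<xi>"

definition omega_R :: "cmat2 \<times> cmat2 \<Rightarrow> cmat2 \<times> cmat2 \<Rightarrow> cmat2" where
  "omega_R p \<xi> = matrix_inv (snd p) ** snd \<xi>"

definition solder_form :: "cmat2 \<times> cmat2 \<Rightarrow> cmat2 \<times> cmat2 \<Rightarrow> mink" where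
  "solder_form p \<xi> = lg_inv ((1/2) *\<^sub>R (omega_L p \<xi> + dagger (omega_R p \<xi>)))"

definition spin_connection :: "cmat2 \<times> cmat2 \<Rightarrow> cmat2 \<times> cmat2 \<Rightarrow> cmat2" where
  "spin_connection p \<xi> = (1/2) *\<^sub>R (omega_L p \<xi> - dagger (omega_R p \<xi>))"

text \<open>
  A tangent vector \<open>X\<^sup>H + U\<^sup>#\<close> has \<open>X\<close> as its solder form and \<open>U\<close> as its connection form;
  \<open>Omega_horizontal_vertical\<close> below recovers the defining equation of the two-form.
\<close>

definition Omega ::
  "cmat2 \<times> cmat2 \<Rightarrow> cmat2 \<times> cmat2 \<Rightarrow> cmat2 \<times> cmat2 \<Rightarrow> real" where
  "Omega p \<xi> \<eta> =
     (let X = solder_form p \<xi>; U = spin_connection p \<xi>;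
          Y = solder_form p \<eta>; V = spin_connection p \<eta>
      in mink_inner X (lg_inv V) - mink_inner (lg_inv U) Y)"

definition smooth_section :: "(cmat2 \<Rightarrow> cmat2 \<times> cmat2) \<Rightarrow> bool" where
  "smooth_section s \<longleftrightarrow>
     smooth_map SU11 s \<and> (\<forall>q\<in>SU11. s q \<in> spin_bundle \<and> bundle_proj (s q) = q)"

definition Omega_Lagrangian_section :: "(cmat2 \<Rightarrow> cmat2 \<times> cmat2) \<Rightarrow> bool" where
  "Omega_Lagrangian_section s \<longleftrightarrow>
     smooth_section s \<and>
     (\<forall>q\<in>SU11. \<forall>v\<in>tangent_space SU11 q. \<forall>w\<in>tangent_space SU11 q.
        pullback2 SU11 s Omega q v w = 0)"


section \<open>The maps \<open>f\<^sub>m\<close> and the sections \<open>s\<^sub>m\<close>\<close>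

definition ell :: mink where "ell = X1 - X0"

definition omega_m :: "nat \<Rightarrow> real" where
  "omega_m m = sqrt (2 / ((real m)\<^sup>2 - 1))"

definition Y_m :: "nat \<Rightarrow> mink" where
  "Y_m m = - (((omega_m m)\<^sup>2 + 11) / 6) *\<^sub>R X0 + (((omega_m m)\<^sup>2 - 7) / 6) *\<^sub>R X1"

definition Z_m :: "nat \<Rightarrow> mink" where
  "Z_m m = - (((omega_m m)\<^sup>2 + 9) / 6) *\<^sub>R X0 + (((omega_m m)\<^sup>2 - 9) / 6) *\<^sub>R X1"

definition a_map :: "real \<Rightarrow> real \<Rightarrow> cmat2" where
  "a_map u w = mat_exp (u *\<^sub>R lg ell) ** mat_exp ((-2 * w) *\<^sub>R lg X2)"

definition b_m :: "nat \<Rightarrow> real \<Rightarrow> cmat2" where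
  "b_m m v = mat_exp ((2 * v) *\<^sub>R lg (Y_m m))"

definition k_m :: "nat \<Rightarrow> real \<Rightarrow> cmat2" where
  "k_m m v = mat_exp ((2 * v) *\<^sub>R lg (Z_m m))"

text \<open>
  Every \<open>q\<close> in SU(1,1) is \<open>a_map u w ** matrix_inv (k_m m v)\<close> for unique \<open>u\<close>, \<open>w\<close> and a \<open>v\<close> that is
  unique modulo \<open>2 * pi / omega_m m\<close>, which is a period of both \<open>k_m m\<close> and \<open>b_m m\<close>; so the
  matrix described here does not depend on the choice of \<open>v\<close>.
\<close>

definition f_m :: "nat \<Rightarrow> cmat2 \<Rightarrow> cmat2" where
  "f_m m q =
     (THE r. \<exists>u w v. q = a_map u w ** matrix_inv (k_m m v) \<and> r = k_m m v ** matrix_inv (b_m m v))"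

definition s_m :: "nat \<Rightarrow> cmat2 \<Rightarrow> cmat2 \<times> cmat2" where
  "s_m m q = (q ** f_m m q, dagger (matrix_inv (f_m m q)))"

section \<open>Consistency of the conventions\<close>

lemma mk_mat2_nth [simp]:
  "mk_mat2 a b c d $ 1 $ 1 = a" "mk_mat2 a b c d $ 1 $ 2 = b"
  "mk_mat2 a b c d $ 2 $ 1 = c" "mk_mat2 a b c d $ 2 $ 2 = d"
  by (simp_all add: mk_mat2_def)

lemma cmat2_eq_iff:
  fixes A B :: cmat2
  shows "A = B \<longleftrightarrow> A $ 1 $ 1 = B $ 1 $ 1 \<and> A $ 1 $ 2 = B $ 1 $ 2 \<and>
                   A $ 2 $ 1 = B $ 2 $ 1 \<and> A $ 2 $ 2 = B $ 2 $ 2"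
  by (auto simp: vec_eq_iff forall_2)

lemma cmat2_mult_nth: "((A::cmat2) ** B) $ i $ j = A $ i $ 1 * B $ 1 $ j + A $ i $ 2 * B $ 2 $ j"
  by (simp add: matrix_matrix_mult_def sum_2)

lemma dagger_nth [simp]: "dagger A $ i $ j = cnj (A $ j $ i)"
  by (simp add: dagger_def)

lemma mat_nth_2 [simp]:
  "(mat c :: cmat2) $ 1 $ 1 = c" "(mat c :: cmat2) $ 1 $ 2 = 0"
  "(mat c :: cmat2) $ 2 $ 1 = 0" "(mat c :: cmat2) $ 2 $ 2 = c"
  by (simp_all add: mat_def)

lemma lg_nth:
  "lg X $ 1 $ 1 = Complex 0 (X $ 0 / 2)" "lg X $ 1 $ 2 = Complex (- X $ 2 / 2) (X $ 1 / 2)"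
  "lg X $ 2 $ 1 = Complex (- X $ 2 / 2) (- X $ 1 / 2)" "lg X $ 2 $ 2 = Complex 0 (- X $ 0 / 2)"
  by (simp_all add: lg_def gamma_def gamma0_def gamma1_def gamma2_def cmat2_mult_nth complex_eq_iff)

lemma lg_linear: "linear lg"
  by (rule linearI) (simp_all add: cmat2_eq_iff lg_nth complex_eq_iff field_simps)

lemma mink_eq_iff: "(X::mink) = Y \<longleftrightarrow> X $ 0 = Y $ 0 \<and> X $ 1 = Y $ 1 \<and> X $ 2 = Y $ 2"
proof -
  have 3: "(3::3) = 0" by simp
  show ?thesis unfolding vec_eq_iff forall_3 3 by blast
qed

lemma su11_iff:
  "A \<in> su11 \<longleftrightarrow> Re (A $ 1 $ 1) = 0 \<and> A $ 2 $ 1 = cnj (A $ 1 $ 2) \<and> A $ 2 $ 2 = - A $ 1 $ 1"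
  by (auto simp: su11_def cmat2_eq_iff cmat2_mult_nth J11_def complex_eq_iff trace_def sum_2)

lemma lg_bij: "bij_betw lg UNIV su11"
proof (rule bij_betwI')
  show "lg X = lg Y \<longleftrightarrow> X = Y" for X Y
    by (auto simp: cmat2_eq_iff lg_nth mink_eq_iff)
  show "lg X \<in> su11" for X
    by (simp add: su11_iff lg_nth complex_eq_iff)
  show "\<exists>X\<in>UNIV. A = lg X" if "A \<in> su11" for A
  proof -
    define X :: mink where "X = (\<chi> i. if i = 0 then 2 * Im (A $ 1 $ 1)
      else if i = 1 then 2 * Im (A $ 1 $ 2) else - 2 * Re (A $ 1 $ 2))"
    have "A = lg X"
      using that by (simp add: su11_iff cmat2_eq_iff lg_nth complex_eq_iff X_def)
    then show ?thesis by blast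
  qed
qed

lemma lg_inv_lg [simp]: "lg_inv (lg X) = X"
  using lg_bij by (simp add: lg_inv_def bij_betw_def)

lemma lg_lg_inv: "A \<in> su11 \<Longrightarrow> lg (lg_inv A) = A"
  using lg_bij by (auto simp: lg_inv_def bij_betw_def intro!: f_inv_into_f)

lemma subspace_su11: "subspace su11"
  by (auto simp: subspace_def su11_iff)

lemma lg_inv_add: "A \<in> su11 \<Longrightarrow> B \<in> su11 \<Longrightarrow> lg_inv (A + B) = lg_inv A + lg_inv B"
  by (metis lg_inv_lg lg_lg_inv lg_linear linear_add)

lemma dagger_su11: "A \<in> su11 \<Longrightarrow> dagger A \<in> su11"
  by (simp add: su11_iff)

lemma SU11_entries:
  assumes "A \<in> SU11"
  shows "A $ 2 $ 1 = cnj (A $ 1 $ 2)" "A $ 2 $ 2 = cnj (A $ 1 $ 1)"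
    "A $ 1 $ 1 * cnj (A $ 1 $ 1) - A $ 1 $ 2 * cnj (A $ 1 $ 2) = 1"
proof -
  have *: "cnj (A $ 1 $ 1) * A $ 1 $ 1 - cnj (A $ 2 $ 1) * A $ 2 $ 1 = 1"
    "cnj (A $ 1 $ 1) * A $ 1 $ 2 - cnj (A $ 2 $ 1) * A $ 2 $ 2 = 0"
    "A $ 1 $ 1 * A $ 2 $ 2 - A $ 1 $ 2 * A $ 2 $ 1 = 1"
    using assms by (auto simp: SU11_def cmat2_eq_iff cmat2_mult_nth J11_def det_2)
  have "A $ 2 $ 2 = (cnj (A $ 1 $ 1) * A $ 1 $ 1 - cnj (A $ 2 $ 1) * A $ 2 $ 1) * A $ 2 $ 2"
    using *(1) by simp
  also have "\<dots> = cnj (A $ 1 $ 1) * (A $ 1 $ 1 * A $ 2 $ 2 - A $ 1 $ 2 * A $ 2 $ 1)"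
    using *(2) by algebra
  finally show 1: "A $ 2 $ 2 = cnj (A $ 1 $ 1)" using *(3) by simp
  have "cnj (A $ 2 $ 1) = cnj (A $ 2 $ 1) * (A $ 1 $ 1 * A $ 2 $ 2 - A $ 1 $ 2 * A $ 2 $ 1)"
    using *(3) by simp
  also have "\<dots> = A $ 1 $ 2 * (cnj (A $ 1 $ 1) * A $ 1 $ 1 - cnj (A $ 2 $ 1) * A $ 2 $ 1)"
    using *(2) by algebra
  finally have "cnj (A $ 2 $ 1) = A $ 1 $ 2" using *(1) by simp
  then show 2: "A $ 2 $ 1 = cnj (A $ 1 $ 2)" by (metis complex_cnj_cnj)
  show "A $ 1 $ 1 * cnj (A $ 1 $ 1) - A $ 1 $ 2 * cnj (A $ 1 $ 2) = 1"
    using *(3) by (simp add: 1 2)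
qed

lemma SU11_inv:
  assumes "A \<in> SU11"
  shows "matrix_inv A = mk_mat2 (A $ 2 $ 2) (- A $ 1 $ 2) (- A $ 2 $ 1) (A $ 1 $ 1)"
proof -
  let ?B = "mk_mat2 (A $ 2 $ 2) (- A $ 1 $ 2) (- A $ 2 $ 1) (A $ 1 $ 1)"
  have "A $ 1 $ 1 * A $ 2 $ 2 - A $ 1 $ 2 * A $ 2 $ 1 = 1"
    using assms by (auto simp: SU11_def det_2)
  then have B: "A ** ?B = mat 1" "?B ** A = mat 1"
    by (simp_all add: cmat2_eq_iff cmat2_mult_nth algebra_simps)
  then have inv: "A ** matrix_inv A = mat 1 \<and> matrix_inv A ** A = mat 1"
    unfolding matrix_inv_def
    using someI[of "\<lambda>B. A ** B = mat 1 \<and> B ** A = mat 1" ?B] by blast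
  have "matrix_inv A = ?B ** A ** matrix_inv A"
    by (simp only: B(2) matrix_mul_lid)
  also have "\<dots> = ?B"
    by (simp only: matrix_mul_assoc[symmetric] inv matrix_mul_rid)
  finally show ?thesis .
qed

lemma SU11_curve_derivative:
  fixes c :: "real \<Rightarrow> cmat2"
  assumes e: "e > 0" and c: "c ` {-e<..<e} \<subseteq> SU11" and d: "(c has_vector_derivative v) (at 0)"
  shows "matrix_inv (c 0) ** v \<in> su11"
proof -
  have nth: "((\<lambda>t. c t $ i $ j) has_vector_derivative v $ i $ j) (at 0)" for i j
    using bounded_linear.has_vector_derivative[OF bounded_linear_vec_nth
        bounded_linear.has_vector_derivative[OF bounded_linear_vec_nth d]] .
  have cnj: "((\<lambda>t. cnj (c t $ i $ j)) has_vector_derivative cnj (v $ i $ j)) (at 0)" for i j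
    using bounded_linear.has_vector_derivative[OF bounded_linear_cnj nth] .
  have S: "c t \<in> SU11" if "t \<in> {-e<..<e}" for t using c that by auto
  have 0: "0 \<in> {-e<..<e}" using e by auto
  have v21: "v $ 2 $ 1 = cnj (v $ 1 $ 2)"
    by (rule vector_derivative_unique_at[OF nth has_vector_derivative_transform_within_open[OF cnj
          open_greaterThanLessThan 0]]) (simp add: SU11_entries S)
  have v22: "v $ 2 $ 2 = cnj (v $ 1 $ 1)"
    by (rule vector_derivative_unique_at[OF nth has_vector_derivative_transform_within_open[OF cnj
          open_greaterThanLessThan 0]]) (simp add: SU11_entries S)
  have "((\<lambda>t. c t $ 1 $ 1 * cnj (c t $ 1 $ 1) - c t $ 1 $ 2 * cnj (c t $ 1 $ 2))
      has_vector_derivative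
      (c 0 $ 1 $ 1 * cnj (v $ 1 $ 1) + v $ 1 $ 1 * cnj (c 0 $ 1 $ 1)
       - (c 0 $ 1 $ 2 * cnj (v $ 1 $ 2) + v $ 1 $ 2 * cnj (c 0 $ 1 $ 2)))) (at 0)"
    by (intro has_vector_derivative_diff has_vector_derivative_mult nth cnj)
  then have "((\<lambda>t. 1) has_vector_derivative
      (c 0 $ 1 $ 1 * cnj (v $ 1 $ 1) + v $ 1 $ 1 * cnj (c 0 $ 1 $ 1)
       - (c 0 $ 1 $ 2 * cnj (v $ 1 $ 2) + v $ 1 $ 2 * cnj (c 0 $ 1 $ 2)))) (at 0)"
    by (rule has_vector_derivative_transform_within_open[OF _ open_greaterThanLessThan 0])
       (simp add: SU11_entries(3) S)
  then have "c 0 $ 1 $ 1 * cnj (v $ 1 $ 1) + v $ 1 $ 1 * cnj (c 0 $ 1 $ 1)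
       - (c 0 $ 1 $ 2 * cnj (v $ 1 $ 2) + v $ 1 $ 2 * cnj (c 0 $ 1 $ 2)) = 0"
    using vector_derivative_unique_at has_vector_derivative_const by blast
  then have "Re (c 0 $ 1 $ 1 * cnj (v $ 1 $ 1) + v $ 1 $ 1 * cnj (c 0 $ 1 $ 1)
       - (c 0 $ 1 $ 2 * cnj (v $ 1 $ 2) + v $ 1 $ 2 * cnj (c 0 $ 1 $ 2))) = 0"
    by simp
  then show ?thesis
    by (simp add: su11_iff SU11_inv[OF S[OF 0]] SU11_entries[OF S[OF 0]] v21 v22 cmat2_mult_nth
        complex_eq_iff algebra_simps)
qed

lemma tangent_spin_bundle:
  assumes "\<xi> \<in> tangent_space spin_bundle p"
  shows "omega_L p \<xi> \<in> su11" "omega_R p \<xi> \<in> su11"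
proof -
  obtain c e where *: "e > 0" "c ` {-e<..<e} \<subseteq> spin_bundle" "c 0 = p"
    "(c has_vector_derivative \<xi>) (at (0::real))"
    using assms by (auto simp: tangent_space_def)
  have "(\<lambda>t. fst (c t)) ` {-e<..<e} \<subseteq> SU11" "(\<lambda>t. snd (c t)) ` {-e<..<e} \<subseteq> SU11"
    using *(2) by (auto simp: spin_bundle_def)
  then show "omega_L p \<xi> \<in> su11" "omega_R p \<xi> \<in> su11"
    using SU11_curve_derivative[OF *(1)] *(3)
      bounded_linear.has_vector_derivative[OF bounded_linear_fst *(4)]
      bounded_linear.has_vector_derivative[OF bounded_linear_snd *(4)]
    by (auto simp: omega_L_def omega_R_def)
qed

lemma dagger_add: "dagger (A + B) = dagger A + dagger B"
  by (simp add: cmat2_eq_iff)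

lemma Omega_horizontal_vertical:
  assumes "\<xi>h \<in> tangent_space spin_bundle p" "\<xi>v \<in> tangent_space spin_bundle p"
    and "\<eta>h \<in> tangent_space spin_bundle p" "\<eta>v \<in> tangent_space spin_bundle p"
    and "solder_form p \<xi>h = X" "spin_connection p \<xi>h = 0"
    and "solder_form p \<xi>v = 0" "spin_connection p \<xi>v = U"
    and "solder_form p \<eta>h = Y" "spin_connection p \<eta>h = 0"
    and "solder_form p \<eta>v = 0" "spin_connection p \<eta>v = V"
  shows "Omega p (\<xi>h + \<xi>v) (\<eta>h + \<eta>v) = mink_inner X (lg_inv V) - mink_inner (lg_inv U) Y"
proof -
  have L: "omega_L p (\<xi> + \<eta>) = omega_L p \<xi> + omega_L p \<eta>"
    and R: "omega_R p (\<xi> + \<eta>) = omega_R p \<xi> + omega_R p \<eta>" for \<xi> \<eta>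
    by (simp_all add: omega_L_def omega_R_def matrix_add_ldistrib)
  have con: "spin_connection p (\<xi> + \<eta>) = spin_connection p \<xi> + spin_connection p \<eta>" for \<xi> \<eta>
    by (simp add: spin_connection_def L R dagger_add algebra_simps)
  have half: "(1/2) *\<^sub>R (omega_L p \<xi> + dagger (omega_R p \<xi>)) \<in> su11"
    if "\<xi> \<in> tangent_space spin_bundle p" for \<xi>
    using tangent_spin_bundle[OF that] dagger_su11 subspace_su11
    by (simp add: subspace_add subspace_scale)
  have sol: "solder_form p (\<xi> + \<eta>) = solder_form p \<xi> + solder_form p \<eta>"
    if "\<xi> \<in> tangent_space spin_bundle p" "\<eta> \<in> tangent_space spin_bundle p" for \<xi> \<eta>
    using lg_inv_add[OF half[OF that(1)] half[OF that(2)]]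
    by (simp add: solder_form_def L R dagger_add algebra_simps)
  show ?thesis
    using assms by (simp add: Omega_def con sol)
qed

end

theory Submission
  imports Defs
begin

text \<open>
  Write \<open>q = a k\<^sup>-\<^sup>1\<close> with \<open>k = exp (2v lg Z)\<close>, \<open>b = exp (2v lg Y)\<close> and \<open>f q = k b\<^sup>-\<^sup>1\<close>. Along the section,
  \<open>\<omega>\<^sup>L = b (a\<^sup>-\<^sup>1 da - 2 lg Y dv) b\<^sup>-\<^sup>1\<close> and \<open>(\<omega>\<^sup>R)\<^sup>\<dagger> = 2 b lg (Y - Z) b\<^sup>-\<^sup>1 dv\<close>, while \<open>\<Omega>\<close> is the
  antisymmetrised pairing of these two forms under the invariant inner product, that is, the trace.
  The \<open>Y\<close>-term contributes \<open>dv \<and> dv = 0\<close>. The other one vanishes because \<open>Y - Z = \<ell> / 3\<close>, and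
  \<open>a\<^sup>-\<^sup>1 da\<close> takes values in the span of \<open>lg \<ell>\<close> and \<open>lg X\<^sub>2\<close>, which is orthogonal to \<open>lg \<ell>\<close>.

  For the smoothness, the closed curves \<open>k\<close> and \<open>b\<close> are images of \<open>z = cis (\<omega> v)\<close> and \<open>z ^ m\<close>
  under ring homomorphisms from the complex numbers to the matrices (\<open>rotor\<close> below), because
  \<open>\<langle>Z, Z\<rangle> = - \<omega>\<^sup>2\<close> and \<open>\<langle>Y, Y\<rangle> = - (m \<omega>)\<^sup>2\<close>; and \<open>z\<close> is an explicit function of \<open>q\<close>.
\<close>

section \<open>Closure properties of smooth maps\<close>

lemma Ck_on_cong:
  assumes "open U" "\<And>x. x \<in> U \<Longrightarrow> f x = g x"
  shows "Ck_on k U f \<longleftrightarrow> Ck_on k U g"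
  using assms(2)
proof (induction k arbitrary: f g)
  case 0
  then show ?case by (simp cong: continuous_on_cong)
next
  case (Suc k)
  have iff: "(f has_derivative D) (at x) \<longleftrightarrow> (g has_derivative D) (at x)" if "x \<in> U" for x D
    using has_derivative_transform_within_open[OF _ \<open>open U\<close> that] Suc.prems by metis
  have "frechet_derivative f (at x) = frechet_derivative g (at x)" if "x \<in> U" for x
    by (simp add: frechet_derivative_def iff that)
  then have "Ck_on k U (\<lambda>x. frechet_derivative f (at x) v) \<longleftrightarrow>
      Ck_on k U (\<lambda>x. frechet_derivative g (at x) v)" for v
    by (intro Suc.IH) simp
  then show ?case by (simp add: differentiable_def iff cong: ball_cong)
qed

text \<open>\<open>frechet_derivative\<close> is a choice; this rule allows any explicit derivative
  \<open>D\<close> in its place, so that each closure proof below is one differentiation rule plus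
  induction.\<close>

lemma Ck_on_SucI:
  assumes "open U" "\<And>x. x \<in> U \<Longrightarrow> (f has_derivative D x) (at x)"
    and "\<And>v. Ck_on k U (\<lambda>x. D x v)"
  shows "Ck_on (Suc k) U f"
proof -
  have "frechet_derivative f (at x) = D x" if "x \<in> U" for x
    using frechet_derivative_at[OF assms(2)[OF that]] by simp
  then have "Ck_on k U (\<lambda>x. frechet_derivative f (at x) v)" for v
    using Ck_on_cong[OF assms(1), of "\<lambda>x. frechet_derivative f (at x) v" "\<lambda>x. D x v"] assms(3)
    by simp
  then show ?thesis using assms(2) by (auto simp: differentiable_def)
qed

lemma Ck_on_SucD:
  assumes "Ck_on (Suc k) U f"
  shows "Ck_on k U f"
  using assms
proof (induction k arbitrary: f)
  case 0
  then show ?case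
    by (auto intro!: continuous_at_imp_continuous_on differentiable_imp_continuous_within)
next
  case (Suc k)
  then show ?case by (metis Ck_on.simps(2))
qed

lemma Ck_on_const: "Ck_on k U (\<lambda>x. c)"
  by (induction k arbitrary: c) (simp_all add: frechet_derivative_const)

lemma Ck_on_bounded_linear:
  assumes "open U" "bounded_linear L" "Ck_on k U f"
  shows "Ck_on k U (\<lambda>x. L (f x))"
  using assms(3)
proof (induction k arbitrary: f)
  case 0
  then show ?case
    by (simp add: bounded_linear.continuous_on[OF assms(2)])
next
  case (Suc k)
  show ?case
  proof (rule Ck_on_SucI[OF assms(1)])
    show "((\<lambda>x. L (f x)) has_derivative (\<lambda>v. L (frechet_derivative f (at x) v))) (at x)"
      if "x \<in> U" for x
      using Suc.prems that
      by (intro bounded_linear.has_derivative[OF assms(2)])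
         (simp add: frechet_derivative_works[symmetric])
  qed (use Suc in simp)
qed

lemma Ck_on_id: "Ck_on k U (\<lambda>x. x)"
proof (cases k)
  case (Suc j)
  then show ?thesis by (simp add: frechet_derivative_ident Ck_on_const)
qed simp

lemma Ck_on_add:
  assumes "open U" "Ck_on k U f" "Ck_on k U g"
  shows "Ck_on k U (\<lambda>x. f x + g x)"
  using assms(2,3)
proof (induction k arbitrary: f g)
  case 0
  then show ?case by (simp add: continuous_on_add)
next
  case (Suc k)
  show ?case
  proof (rule Ck_on_SucI[OF assms(1)])
    show "((\<lambda>x. f x + g x) has_derivative
        (\<lambda>v. frechet_derivative f (at x) v + frechet_derivative g (at x) v)) (at x)"
      if "x \<in> U" for x
      using Suc.prems that
      by (intro has_derivative_add) (simp_all add: frechet_derivative_works[symmetric])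
  qed (use Suc in simp)
qed

text \<open>Leibniz rule. Each summand of the derivative keeps one factor undifferentiated, so
  \<open>Ck_on_SucD\<close> lowers that factor to the order of the induction hypothesis.\<close>

lemma Ck_on_bounded_bilinear:
  assumes "open U" "bounded_bilinear h" "Ck_on k U f" "Ck_on k U g"
  shows "Ck_on k U (\<lambda>x. h (f x) (g x))"
  using assms(3,4)
proof (induction k arbitrary: f g)
  case 0
  then show ?case by (simp add: bounded_bilinear.continuous_on[OF assms(2)])
next
  case (Suc k)
  show ?case
  proof (rule Ck_on_SucI[OF assms(1)])
    show "((\<lambda>x. h (f x) (g x)) has_derivative
        (\<lambda>v. h (f x) (frechet_derivative g (at x) v)
             + h (frechet_derivative f (at x) v) (g x))) (at x)"
      if "x \<in> U" for x
      using Suc.prems that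
      by (intro bounded_bilinear.FDERIV[OF assms(2)])
         (simp_all add: frechet_derivative_works[symmetric])
    show "Ck_on k U (\<lambda>x. h (f x) (frechet_derivative g (at x) v)
        + h (frechet_derivative f (at x) v) (g x))" for v
      using Suc.prems Suc.prems[THEN Ck_on_SucD]
      by (intro Ck_on_add[OF assms(1)] Suc.IH) simp_all
  qed
qed

lemma Ck_on_powr:
  fixes f :: "'a::euclidean_space \<Rightarrow> real"
  assumes "open U" "\<And>x. x \<in> U \<Longrightarrow> f x > 0" "Ck_on k U f"
  shows "Ck_on k U (\<lambda>x. f x powr p)"
  using assms(3)
\<comment> \<open>Differentiation turns the exponent \<open>p\<close> into \<open>p - 1\<close>, so
  the induction must generalise over \<open>p\<close>.\<close>
proof (induction k arbitrary: p)
  case 0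
  then show ?case using assms(2) by (force intro!: continuous_intros)
next
  case (Suc k)
  show ?case
  proof (rule Ck_on_SucI[OF assms(1)])
    show "((\<lambda>x. f x powr p) has_derivative
        (\<lambda>v. (p * f x powr (p - 1)) * frechet_derivative f (at x) v)) (at x)"
      if "x \<in> U" for x
    proof -
      have "(f has_derivative frechet_derivative f (at x)) (at x)"
        using Suc.prems that by (simp add: frechet_derivative_works[symmetric])
      moreover have "((\<lambda>y. y powr p) has_derivative (\<lambda>h. (p * f x powr (p - 1)) * h)) (at (f x))"
        using has_real_derivative_powr[OF assms(2)[OF that], of p]
        by (simp add: has_field_derivative_def)
      ultimately show ?thesis by (rule has_derivative_compose)
    qed
    show "Ck_on k U (\<lambda>x. (p * f x powr (p - 1)) * frechet_derivative f (at x) v)" for v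
    proof (rule Ck_on_bounded_bilinear[OF assms(1) bounded_bilinear_mult])
      show "Ck_on k U (\<lambda>x. p * f x powr (p - 1))"
        using Ck_on_SucD[OF Suc.prems]
        by (intro Ck_on_bounded_linear[OF assms(1) bounded_linear_mult_right] Suc.IH)
      show "Ck_on k U (\<lambda>x. frechet_derivative f (at x) v)"
        using Suc.prems by simp
    qed
  qed
qed

lemma smooth_on_differentiable: "smooth_on U f \<Longrightarrow> x \<in> U \<Longrightarrow> f differentiable (at x)"
  unfolding smooth_on_def by (metis Ck_on.simps(2))

section \<open>The group SU(1,1) and the trace form\<close>

lemma bounded_linear_cmat2_nth: "bounded_linear (\<lambda>A::cmat2. A $ i $ j)"
  by (intro bounded_linear_compose[OF bounded_linear_vec_nth bounded_linear_vec_nth, unfolded o_def])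

lemma bounded_bilinear_matrix_mult: "bounded_bilinear ((**) :: cmat2 \<Rightarrow> cmat2 \<Rightarrow> cmat2)"
  unfolding bilinear_conv_bounded_bilinear[symmetric] bilinear_def
  by (auto intro!: linearI simp: cmat2_eq_iff cmat2_mult_nth algebra_simps)

lemma bounded_linear_dagger: "bounded_linear dagger"
  unfolding linear_conv_bounded_linear[symmetric]
  by (auto intro!: linearI simp: cmat2_eq_iff)

lemma SU11_iff:
  "A \<in> SU11 \<longleftrightarrow> A $ 2 $ 1 = cnj (A $ 1 $ 2) \<and> A $ 2 $ 2 = cnj (A $ 1 $ 1) \<and>
     A $ 1 $ 1 * cnj (A $ 1 $ 1) - A $ 1 $ 2 * cnj (A $ 1 $ 2) = 1"
  (is "?l \<longleftrightarrow> ?r")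
proof
  assume ?r
  then show ?l by (auto simp: SU11_def cmat2_eq_iff cmat2_mult_nth J11_def det_2 algebra_simps)
qed (simp add: SU11_entries)

lemma dagger_mult: "dagger (A ** B) = dagger B ** dagger A"
  by (simp add: cmat2_eq_iff cmat2_mult_nth mult.commute)

lemma SU11_mult: "A \<in> SU11 \<Longrightarrow> B \<in> SU11 \<Longrightarrow> A ** B \<in> SU11"
  unfolding SU11_def mem_Collect_eq dagger_mult det_mul by (metis matrix_mul_assoc mult_1)

lemma SU11_dagger: "A \<in> SU11 \<Longrightarrow> dagger A \<in> SU11"
  unfolding SU11_iff by (simp add: mult.commute)

lemma dagger_dagger [simp]: "dagger (dagger A) = A"
  by (simp add: cmat2_eq_iff)

lemma matrix_inv_eqI:
  fixes A B :: "'a::field^'n^'n"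
  assumes "A ** B = mat 1"
  shows "matrix_inv A = B"
proof -
  have "B ** A = mat 1" using assms by (simp add: matrix_left_right_inverse)
  then have "matrix_inv A ** A = mat 1"
    unfolding matrix_inv_def using assms someI[of "\<lambda>B. A ** B = mat 1 \<and> B ** A = mat 1" B] by blast
  then show ?thesis
    by (metis assms matrix_mul_assoc matrix_mul_lid matrix_mul_rid)
qed

lemma SU11_mult_inv:
  assumes "A \<in> SU11"
  shows "A ** matrix_inv A = mat 1" "matrix_inv A ** A = mat 1"
  using assms unfolding SU11_inv[OF assms]
  by (simp_all add: SU11_iff cmat2_eq_iff cmat2_mult_nth algebra_simps)

text \<open>Up to the factor 2 the Minkowski product is the trace form, which makes it invariant
  under conjugation.\<close>

lemma mink_inner_lg_inv:
  assumes "A \<in> su11" "B \<in> su11"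
  shows "mink_inner (lg_inv A) (lg_inv B) = 2 * Re (trace (A ** B))"
proof -
  obtain X Y where "A = lg X" "B = lg Y" using assms lg_lg_inv by metis
  then show ?thesis
    by (simp add: mink_inner_def trace_def sum_2 cmat2_mult_nth lg_nth field_simps)
qed

lemma trace_conjugate:
  fixes A B :: "'a::comm_semiring_1^'n^'n"
  assumes "C ** B = mat 1"
  shows "trace (B ** A ** C) = trace A"
  by (metis assms matrix_mul_assoc matrix_mul_lid trace_mul_sym)

lemma su11_conjugate:
  assumes "B \<in> SU11" "A \<in> su11"
  shows "B ** A ** matrix_inv B \<in> su11"
proof -
  have "Re (B $ 1 $ 1 * cnj (B $ 1 $ 1) - B $ 1 $ 2 * cnj (B $ 1 $ 2)) = 1"
    using assms(1) by (simp add: SU11_iff)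
  then have *: "Re (B $ 1 $ 1) * Re (B $ 1 $ 1) = 1 + Re (B $ 1 $ 2) * Re (B $ 1 $ 2)
      + Im (B $ 1 $ 2) * Im (B $ 1 $ 2) - Im (B $ 1 $ 1) * Im (B $ 1 $ 1)"
    by simp
  \<comment> \<open>The same rewrite rule as \<open>*\<close>, in the right-nested form that
    \<open>algebra_simps\<close> produces inside longer products.\<close>
  have **: "Re (B $ 1 $ 1) * (Re (B $ 1 $ 1) * x) = (1 + Re (B $ 1 $ 2) * Re (B $ 1 $ 2)
      + Im (B $ 1 $ 2) * Im (B $ 1 $ 2) - Im (B $ 1 $ 1) * Im (B $ 1 $ 1)) * x" for x
    by (simp add: * mult.assoc[symmetric])
  show ?thesis
    using assms unfolding SU11_inv[OF assms(1)] su11_iff SU11_iff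
    by (simp add: cmat2_mult_nth complex_eq_iff algebra_simps * **)
qed

section \<open>Elliptic one-parameter subgroups\<close>

text \<open>The imaginary unit goes to \<open>(2 / r) *\<^sub>R lg X\<close>, whose square is minus
  the identity when \<open>mink_inner X X = - r\<^sup>2\<close>; this makes the map
  multiplicative.\<close>

definition rotor :: "mink \<Rightarrow> real \<Rightarrow> complex \<Rightarrow> cmat2" where
  "rotor X r z = Re z *\<^sub>R mat 1 + (2 * Im z / r) *\<^sub>R lg X"

lemma rotor_nth:
  "rotor X r z $ 1 $ 1 = Complex (Re z) (Im z / r * X $ 0)"
  "rotor X r z $ 1 $ 2 = Complex (- (Im z / r * X $ 2)) (Im z / r * X $ 1)"
  "rotor X r z $ 2 $ 1 = Complex (- (Im z / r * X $ 2)) (- (Im z / r * X $ 1))"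
  "rotor X r z $ 2 $ 2 = Complex (Re z) (- (Im z / r * X $ 0))"
  by (simp_all add: rotor_def lg_nth complex_eq_iff)

lemma bounded_linear_rotor: "bounded_linear (rotor X r)"
  unfolding linear_conv_bounded_linear[symmetric]
  by (auto intro!: linearI simp: rotor_def algebra_simps add_divide_distrib)

lemma rotor_1 [simp]: "rotor X r 1 = mat 1"
  by (simp add: rotor_def)

lemma rotor_imaginary: "rotor X r (\<i> * of_real t) = (2 * t / r) *\<^sub>R lg X"
  by (simp add: rotor_def)

context
  fixes X :: mink and r :: real
  assumes X: "mink_inner X X = - r\<^sup>2" and r: "r \<noteq> 0"
begin

lemma rotor_mult: "rotor X r z ** rotor X r w = rotor X r (z * w)"
proof -
  have "(X $ 0)\<^sup>2 = r\<^sup>2 + (X $ 1)\<^sup>2 + (X $ 2)\<^sup>2"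
    using X by (simp add: mink_inner_def power2_eq_square)
  then have *: "X $ 0 * X $ 0 = r * r + X $ 1 * X $ 1 + X $ 2 * X $ 2"
    by (simp add: power2_eq_square)
  show ?thesis
    using r by (simp add: cmat2_eq_iff cmat2_mult_nth rotor_nth complex_eq_iff field_simps)
       (simp add: * algebra_simps)
qed

lemma rotor_SU11:
  assumes "norm z = 1"
  shows "rotor X r z \<in> SU11"
proof -
  have "(Re z)\<^sup>2 + (Im z)\<^sup>2 = 1" using assms by (simp add: cmod_def)
  moreover have "(X $ 0)\<^sup>2 = r\<^sup>2 + (X $ 1)\<^sup>2 + (X $ 2)\<^sup>2"
    using X by (simp add: mink_inner_def power2_eq_square)
  then have "(Im z / r * X $ 0)\<^sup>2 = (Im z)\<^sup>2 + (Im z / r * X $ 1)\<^sup>2 + (Im z / r * X $ 2)\<^sup>2"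
    using r by (simp add: power_mult_distrib power_divide field_simps)
  ultimately show ?thesis
    by (simp add: SU11_iff rotor_nth complex_eq_iff power2_eq_square)
qed

lemma rotor_mult_cnj:
  assumes "norm z = 1"
  shows "rotor X r z ** rotor X r (cnj z) = mat 1" "rotor X r (cnj z) ** rotor X r z = mat 1"
  using assms complex_norm_square[of z] by (simp_all add: rotor_mult mult.commute)

lemma matrix_inv_rotor:
  assumes "norm z = 1"
  shows "matrix_inv (rotor X r z) = rotor X r (cnj z)"
  by (rule matrix_inv_eqI) (rule rotor_mult_cnj[OF assms])

text \<open>A bounded linear multiplicative map commutes with the exponential series term by
  term.\<close>

lemma mat_exp_rotor: "mat_exp (rotor X r z) = rotor X r (exp z)"
proof -
  have "mat_pow (rotor X r z) n = rotor X r (z ^ n)" for n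
    by (induction n) (simp_all add: rotor_mult)
  moreover have "(\<lambda>n. rotor X r (z ^ n /\<^sub>R fact n)) sums rotor X r (exp z)"
    by (rule bounded_linear.sums[OF bounded_linear_rotor exp_converges])
  ultimately show ?thesis
    by (simp add: mat_exp_def sums_iff inverse_eq_divide
        linear_cmul[OF bounded_linear.linear[OF bounded_linear_rotor]])
qed

lemma mat_exp_elliptic: "mat_exp ((2 * v) *\<^sub>R lg X) = rotor X r (cis (r * v))"
  using mat_exp_rotor[of "\<i> * of_real (r * v)"] r
  unfolding rotor_imaginary by (simp add: cis_conv_exp)

end

section \<open>The section in closed form\<close>

lemma omega_m_pos: "m \<ge> 2 \<Longrightarrow> omega_m m > 0"
  unfolding omega_m_def by (simp add: one_less_power)

lemma mink_inner_Z_m: "mink_inner (Z_m m) (Z_m m) = - (omega_m m)\<^sup>2"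
  by (simp add: mink_inner_def Z_m_def X0_def X1_def axis_def field_simps power2_eq_square)

lemma mink_inner_Y_m:
  assumes "m \<ge> 2"
  shows "mink_inner (Y_m m) (Y_m m) = - (real m * omega_m m)\<^sup>2"
proof -
  have 1: "(real m)\<^sup>2 > 1" using assms by (simp add: one_less_power)
  have "(omega_m m)\<^sup>2 = 2 / ((real m)\<^sup>2 - 1)" using 1 by (simp add: omega_m_def)
  then have "(omega_m m)\<^sup>2 * ((real m)\<^sup>2 - 1) = 2" using 1 by (simp only: nonzero_eq_divide_eq)
  \<comment> \<open>This is where the value of \<open>omega_m\<close> enters: \<open>b_m\<close>
    gets exactly \<open>m\<close> times the frequency of \<open>k_m\<close>, so it is a function of
    the same point of the circle.\<close>
  then have *: "(real m * omega_m m)\<^sup>2 = (omega_m m)\<^sup>2 + 2"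
    by (simp add: power_mult_distrib algebra_simps)
  show ?thesis unfolding *
    by (simp add: mink_inner_def Y_m_def X0_def X1_def axis_def field_simps power2_eq_square)
qed

lemma Y_m_minus_Z_m: "lg (Y_m m) - lg (Z_m m) = (1/3) *\<^sub>R lg ell"
  unfolding linear_diff[OF lg_linear, symmetric] linear_cmul[OF lg_linear, symmetric]
  by (rule arg_cong[of _ _ lg])
    (simp add: mink_eq_iff Y_m_def Z_m_def ell_def X0_def X1_def axis_def field_simps)

abbreviation k_rotor :: "nat \<Rightarrow> complex \<Rightarrow> cmat2" where
  "k_rotor m \<equiv> rotor (Z_m m) (omega_m m)"

abbreviation b_rotor :: "nat \<Rightarrow> complex \<Rightarrow> cmat2" where
  "b_rotor m \<equiv> rotor (Y_m m) (real m * omega_m m)"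

lemma k_m_eq: "m \<ge> 2 \<Longrightarrow> k_m m v = k_rotor m (cis (omega_m m * v))"
  unfolding k_m_def
  using omega_m_pos[of m] by (simp add: mat_exp_elliptic mink_inner_Z_m)

lemma b_m_eq: "m \<ge> 2 \<Longrightarrow> b_m m v = b_rotor m (cis (omega_m m * v) ^ m)"
  unfolding b_m_def
  using omega_m_pos[of m] by (simp add: mat_exp_elliptic mink_inner_Y_m Complex.DeMoivre mult.assoc)

section \<open>Explicit form and image of \<open>a_map\<close>\<close>

lemma mat_exp_nilpotent:
  assumes "N ** N = 0"
  shows "mat_exp N = mat 1 + N"
proof -
  have "mat_pow N (Suc (Suc n)) = 0" for n
    using assms by (simp add: matrix_mul_assoc)
  then have "mat_pow N n = 0" if "n \<notin> {..<2}" for n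
    using that by (cases n; cases "n - 1") auto
  then have "mat_exp N = (\<Sum>n<2. (1 / fact n) *\<^sub>R mat_pow N n)"
    unfolding mat_exp_def by (intro suminf_finite) auto
  then show ?thesis by (simp add: numeral_2_eq_2)
qed

text \<open>Even powers of \<open>S\<close> are the identity and odd ones are \<open>S\<close>, so
  the series splits into those of cosh and sinh.\<close>

lemma mat_exp_involution:
  assumes "S ** S = mat 1"
  shows "mat_exp (w *\<^sub>R S) = cosh w *\<^sub>R mat 1 + sinh w *\<^sub>R S"
proof -
  have pow: "mat_pow (w *\<^sub>R S) n = w ^ n *\<^sub>R (if even n then mat 1 else S)" for n
    by (induction n) (simp_all add: assms bounded_bilinear.scaleR_left[OF bounded_bilinear_matrix_mult]
        bounded_bilinear.scaleR_right[OF bounded_bilinear_matrix_mult])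
  have "(\<lambda>n. (if even n then w ^ n /\<^sub>R fact n else 0) *\<^sub>R mat 1 +
      (if even n then 0 else w ^ n /\<^sub>R fact n) *\<^sub>R S) sums (cosh w *\<^sub>R mat 1 + sinh w *\<^sub>R S)"
    by (intro sums_add sums_scaleR_left cosh_converges sinh_converges)
  moreover have "(if even n then w ^ n /\<^sub>R fact n else 0) *\<^sub>R mat 1 +
      (if even n then 0 else w ^ n /\<^sub>R fact n) *\<^sub>R S = (1 / fact n) *\<^sub>R mat_pow (w *\<^sub>R S) n" for n
    by (simp add: pow inverse_eq_divide)
  ultimately show ?thesis by (simp add: mat_exp_def sums_iff)
qed

lemma a_map_nth:
  "a_map u w $ 1 $ 1 = Complex (cosh w) (- (u * exp (- w) / 2))"
  "a_map u w $ 1 $ 2 = Complex (sinh w) (u * exp (- w) / 2)"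
  "a_map u w $ 2 $ 1 = cnj (a_map u w $ 1 $ 2)"
  "a_map u w $ 2 $ 2 = cnj (a_map u w $ 1 $ 1)"
proof -
  \<comment> \<open>\<open>ell\<close> is a null vector, so \<open>?N\<close> squares to zero;
    \<open>X2\<close> is a spacelike unit vector, so \<open>?S\<close> is an involution.\<close>
  let ?N = "u *\<^sub>R lg ell" and ?S = "(-2) *\<^sub>R lg X2"
  have N: "mat_exp ?N = mat 1 + ?N"
    by (rule mat_exp_nilpotent)
      (simp add: cmat2_eq_iff cmat2_mult_nth lg_nth ell_def X0_def X1_def axis_def complex_eq_iff)
  have "?S ** ?S = mat 1"
    by (simp add: cmat2_eq_iff cmat2_mult_nth lg_nth X2_def axis_def complex_eq_iff)
  from mat_exp_involution[OF this]
  have S: "mat_exp ((-2 * w) *\<^sub>R lg X2) = cosh w *\<^sub>R mat 1 + sinh w *\<^sub>R ?S"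
    by (simp add: mult.commute)
  show "a_map u w $ 1 $ 1 = Complex (cosh w) (- (u * exp (- w) / 2))"
    "a_map u w $ 1 $ 2 = Complex (sinh w) (u * exp (- w) / 2)"
    "a_map u w $ 2 $ 1 = cnj (a_map u w $ 1 $ 2)"
    "a_map u w $ 2 $ 2 = cnj (a_map u w $ 1 $ 1)"
    unfolding a_map_def N S cmat2_mult_nth
    by (simp_all add: lg_nth ell_def X0_def X1_def X2_def axis_def complex_eq_iff cosh_def sinh_def field_simps)
qed

lemma a_map_SU11: "a_map u w \<in> SU11"
  using hyperbolic_pythagoras[of w]
  by (simp add: SU11_iff a_map_nth(3,4))
     (simp add: a_map_nth complex_eq_iff power2_eq_square)

lemma a_map_row_sum: "a_map u w $ 1 $ 1 + a_map u w $ 1 $ 2 = of_real (exp w)"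
  by (simp add: a_map_nth complex_eq_iff cosh_plus_sinh)

text \<open>For a first row \<open>(x, \<rho> - x)\<close> the quadratic condition on SU(1,1)
  becomes linear in \<open>x\<close>: it fixes the real part and leaves only the imaginary part
  free.\<close>

lemma SU11_row_sum_Re:
  assumes "A \<in> SU11" "A $ 1 $ 1 + A $ 1 $ 2 = of_real \<rho>"
  shows "2 * \<rho> * Re (A $ 1 $ 1) = \<rho>\<^sup>2 + 1"
proof -
  have y: "A $ 1 $ 2 = of_real \<rho> - A $ 1 $ 1" using assms(2) by (simp add: algebra_simps)
  have "Re (A $ 1 $ 1 * cnj (A $ 1 $ 1) - A $ 1 $ 2 * cnj (A $ 1 $ 2)) = 1"
    using SU11_entries(3)[OF assms(1)] by simp
  then show ?thesis by (simp add: y power2_eq_square algebra_simps)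
qed

lemma ex_a_map:
  assumes "A \<in> SU11" "A $ 1 $ 1 + A $ 1 $ 2 = of_real \<rho>" "\<rho> > 0"
  shows "\<exists>u w. A = a_map u w"
proof -
  \<comment> \<open>Solved from \<open>a_map_nth\<close>: the row sum is \<open>exp w\<close>, and
    the imaginary part of the first entry is \<open>- u * exp (- w) / 2\<close>.\<close>
  let ?u = "- 2 * \<rho> * Im (A $ 1 $ 1)" and ?w = "ln \<rho>"
  have y: "A $ 1 $ 2 = of_real \<rho> - A $ 1 $ 1" using assms(2) by (simp add: algebra_simps)
  have "A = a_map ?u ?w"
    using assms(3) SU11_row_sum_Re[OF assms(1,2)]
    by (simp add: cmat2_eq_iff a_map_nth(3,4) SU11_entries[OF assms(1)])
       (simp add: a_map_nth y complex_eq_iff cosh_def sinh_def exp_minus field_simps power2_eq_square)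
  then show ?thesis by blast
qed

text \<open>
  The vector \<open>(1, 1)\<close> spans the kernel of \<open>lg ell\<close> and is an eigenvector of \<open>lg X2\<close>, so
  \<open>q = a_map u w ** matrix_inv (k_m m v)\<close> maps \<open>k_m m v *v (1, 1)\<close> to \<open>exp w *\<^sub>R (1, 1)\<close>. The first
  coordinate of \<open>matrix_inv q *v (1, 1)\<close> is the number \<open>p\<close> below, hence
  \<open>phase q = exp (- w) *\<^sub>R cis (omega_m m * v)\<close>.
\<close>

definition phase :: "nat \<Rightarrow> cmat2 \<Rightarrow> complex" where
  "phase m q = (let p = cnj (q $ 1 $ 1) - q $ 1 $ 2 in Complex (Re p) (- (omega_m m / 3 * Im p)))"

lemma phase_mult_rotor:
  assumes "A \<in> SU11" "A $ 1 $ 1 + A $ 1 $ 2 = of_real \<rho>" "\<rho> \<noteq> 0" "m \<ge> 2"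
  shows "phase m (A ** k_rotor m (cnj z)) = z /\<^sub>R \<rho>"
proof -
  have y: "A $ 1 $ 2 = of_real \<rho> - A $ 1 $ 1" using assms(2) by (simp add: algebra_simps)
  have x: "Re (A $ 1 $ 1) = (\<rho>\<^sup>2 + 1) / (2 * \<rho>)"
    using SU11_row_sum_Re[OF assms(1,2)] assms(3) by (simp add: field_simps)
  show ?thesis
    using assms(3) omega_m_pos[OF assms(4)]
    by (simp add: phase_def Let_def cmat2_mult_nth rotor_nth complex_eq_iff y Z_m_def X0_def X1_def
        axis_def)
      (simp add: x field_simps power2_eq_square)
qed

text \<open>The matrices \<open>k_rotor m (phase m q)\<close> and \<open>matrix_inv q\<close> send
  (1, 1) to the same vector, so the product with \<open>q\<close> fixes (1, 1).\<close>

lemma row_sum_phase: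
  assumes "q \<in> SU11" "m \<ge> 2"
  shows "(q ** k_rotor m (phase m q)) $ 1 $ 1 + (q ** k_rotor m (phase m q)) $ 1 $ 2 = 1"
proof -
  have norm: "Re (q $ 1 $ 1 * cnj (q $ 1 $ 1) - q $ 1 $ 2 * cnj (q $ 1 $ 2)) = 1"
    using SU11_entries(3)[OF assms(1)] by simp
  \<comment> \<open>The two components add up to -3, which explains the factor
    \<open>- (omega_m m / 3)\<close> in \<open>phase\<close>.\<close>
  have Z: "Z_m m $ 1 = - 3 - Z_m m $ 0" "Z_m m $ 2 = 0"
    by (simp_all add: Z_m_def X0_def X1_def axis_def field_simps)
  have *: "Im (phase m q) / omega_m m = (Im (q $ 1 $ 1) + Im (q $ 1 $ 2)) / 3"
    "Re (phase m q) = Re (q $ 1 $ 1) - Re (q $ 1 $ 2)"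
    using omega_m_pos[OF assms(2)] by (simp_all add: phase_def Let_def field_simps)
  from norm show ?thesis
    unfolding cmat2_mult_nth rotor_nth * Z by (simp add: complex_eq_iff field_simps)
qed

text \<open>At phase 0 the rotor is the zero matrix, against the row sum 1. Hence normalising the
  phase is harmless near SU(1,1).\<close>

lemma phase_nonzero:
  assumes "q \<in> SU11" "m \<ge> 2"
  shows "phase m q \<noteq> 0"
proof
  assume "phase m q = 0"
  with row_sum_phase[OF assms] show False by (simp add: cmat2_mult_nth rotor_nth complex_eq_iff)
qed

text \<open>The circle coordinate of \<open>q\<close>: normalising removes the factor
  \<open>exp (- w)\<close> from the phase.\<close>

abbreviation zeta :: "nat \<Rightarrow> cmat2 \<Rightarrow> complex" where
  "zeta m q \<equiv> sgn (phase m q)"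

lemma norm_zeta: "q \<in> SU11 \<Longrightarrow> m \<ge> 2 \<Longrightarrow> norm (zeta m q) = 1"
  by (simp add: norm_sgn phase_nonzero)

lemma k_rotor_SU11: "m \<ge> 2 \<Longrightarrow> norm z = 1 \<Longrightarrow> k_rotor m z \<in> SU11"
  using omega_m_pos[of m] by (intro rotor_SU11 mink_inner_Z_m) auto

lemma b_rotor_SU11: "m \<ge> 2 \<Longrightarrow> norm z = 1 \<Longrightarrow> b_rotor m z \<in> SU11"
  using omega_m_pos[of m] by (intro rotor_SU11 mink_inner_Y_m) auto

lemma matrix_inv_k_rotor: "m \<ge> 2 \<Longrightarrow> norm z = 1 \<Longrightarrow> matrix_inv (k_rotor m z) = k_rotor m (cnj z)"
  using omega_m_pos[of m] by (intro matrix_inv_rotor mink_inner_Z_m) auto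

lemma matrix_inv_b_rotor: "m \<ge> 2 \<Longrightarrow> norm z = 1 \<Longrightarrow> matrix_inv (b_rotor m z) = b_rotor m (cnj z)"
  using omega_m_pos[of m] by (intro matrix_inv_rotor mink_inner_Y_m) auto

lemma row_sum_zeta:
  assumes "q \<in> SU11" "m \<ge> 2"
  shows "(q ** k_rotor m (zeta m q)) $ 1 $ 1 + (q ** k_rotor m (zeta m q)) $ 1 $ 2
    = of_real (inverse (norm (phase m q)))"
proof -
  have "q ** k_rotor m (zeta m q) = inverse (norm (phase m q)) *\<^sub>R (q ** k_rotor m (phase m q))"
    by (simp add: sgn_div_norm linear_cmul[OF bounded_linear.linear[OF bounded_linear_rotor]]
        bounded_bilinear.scaleR_right[OF bounded_bilinear_matrix_mult] inverse_eq_divide)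
  with row_sum_phase[OF assms] show ?thesis
    by (simp add: scaleR_right_distrib[symmetric]) (simp add: scaleR_conv_of_real)
qed

section \<open>Existence of the decomposition and well-definedness of \<open>f_m\<close>\<close>

lemma zeta_decomposition:
  assumes "m \<ge> 2"
  shows "zeta m (a_map u w ** matrix_inv (k_m m v)) = cis (omega_m m * v)"
  unfolding k_m_eq[OF assms] matrix_inv_k_rotor[OF assms norm_cis]
  by (subst phase_mult_rotor[OF a_map_SU11 a_map_row_sum _ assms])
    (simp_all add: sgn_scaleR sgn_div_norm)

lemma ex_decomposition:
  assumes "q \<in> SU11" "m \<ge> 2"
  shows "\<exists>u w v. q = a_map u w ** matrix_inv (k_m m v)"
proof -
  let ?z = "zeta m q"
  define v where "v = Arg ?z / omega_m m"
  have z: "?z = cis (omega_m m * v)"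
    using omega_m_pos[OF assms(2)] norm_zeta[OF assms] cis_Arg[of ?z] phase_nonzero[OF assms]
    by (auto simp: v_def sgn_zero_iff)
  have A: "q ** k_m m v \<in> SU11"
    unfolding k_m_eq[OF assms(2)] z[symmetric]
    using assms norm_zeta by (intro SU11_mult k_rotor_SU11)
  obtain u w where "q ** k_m m v = a_map u w"
    \<comment> \<open>Multiplying by \<open>k_m m v\<close> makes the row sum a positive real
      number, which is what places the product in the image of \<open>a_map\<close>.\<close>
    using ex_a_map[OF A, unfolded k_m_eq[OF assms(2)] z[symmetric], OF row_sum_zeta[OF assms]]
      phase_nonzero[OF assms] by (auto simp: k_m_eq[OF assms(2)] z[symmetric])
  moreover have "k_m m v ** matrix_inv (k_m m v) = mat 1"
    unfolding k_m_eq[OF assms(2)] by (rule SU11_mult_inv) (simp add: k_rotor_SU11 assms)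
  ultimately have "q = a_map u w ** matrix_inv (k_m m v)"
    by (metis matrix_mul_assoc matrix_mul_rid)
  then show ?thesis by blast
qed

text \<open>Both \<open>k_m\<close> and \<open>b_m\<close> depend on \<open>v\<close> only through
  \<open>cis (omega_m m * v)\<close>, which \<open>zeta_decomposition\<close> recovers from
  \<open>q\<close>; so all decompositions give the same matrix and the description is
  unique.\<close>

lemma f_m_eq:
  assumes "q \<in> SU11" "m \<ge> 2"
  shows "f_m m q = k_rotor m (zeta m q) ** b_rotor m (cnj (zeta m q ^ m))"
proof -
  have "k_m m v ** matrix_inv (b_m m v) = k_rotor m (zeta m q) ** b_rotor m (cnj (zeta m q ^ m))"
    if "q = a_map u w ** matrix_inv (k_m m v)" for u w v
    unfolding that zeta_decomposition[OF assms(2)]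
    by (simp add: k_m_eq b_m_eq assms(2) matrix_inv_b_rotor norm_power)
  with ex_decomposition[OF assms] show ?thesis
    unfolding f_m_def by (intro the_equality) (metis, metis)
qed

lemma f_m_SU11:
  assumes "q \<in> SU11" "m \<ge> 2"
  shows "f_m m q \<in> SU11"
  unfolding f_m_eq[OF assms]
  using assms norm_zeta[OF assms] by (intro SU11_mult k_rotor_SU11 b_rotor_SU11) (simp_all add: norm_power)

lemma matrix_inv_f_m:
  assumes "q \<in> SU11" "m \<ge> 2"
  shows "matrix_inv (f_m m q) = b_rotor m (zeta m q ^ m) ** k_rotor m (cnj (zeta m q))"
proof (rule matrix_inv_eqI)
  have z: "norm (zeta m q) = 1" "norm (zeta m q ^ m) = 1"
    using norm_zeta[OF assms] by (simp_all add: norm_power)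
  have "b_rotor m (cnj (zeta m q ^ m)) ** b_rotor m (zeta m q ^ m) = mat 1"
    using rotor_mult_cnj[OF mink_inner_Y_m _ z(2)] omega_m_pos[of m] assms(2) by auto
  moreover have "k_rotor m (zeta m q) ** k_rotor m (cnj (zeta m q)) = mat 1"
    using rotor_mult_cnj[OF mink_inner_Z_m _ z(1)] omega_m_pos[of m] assms(2) by auto
  ultimately show "f_m m q ** (b_rotor m (zeta m q ^ m) ** k_rotor m (cnj (zeta m q))) = mat 1"
    unfolding f_m_eq[OF assms] by (metis matrix_mul_assoc matrix_mul_rid)
qed

text \<open>A formula for \<open>s_m\<close> that makes sense off SU(1,1): inverses of rotors are
  replaced by conjugating their arguments.\<close>

definition s_ext :: "nat \<Rightarrow> cmat2 \<Rightarrow> cmat2 \<times> cmat2" where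
  "s_ext m q = (q ** k_rotor m (zeta m q) ** b_rotor m (cnj (zeta m q ^ m)),
     dagger (b_rotor m (zeta m q ^ m) ** k_rotor m (cnj (zeta m q))))"

lemma s_m_eq: "q \<in> SU11 \<Longrightarrow> m \<ge> 2 \<Longrightarrow> s_m m q = s_ext m q"
  by (simp add: s_m_def s_ext_def matrix_inv_f_m) (simp add: f_m_eq matrix_mul_assoc)

lemma s_m_section:
  assumes "q \<in> SU11" "m \<ge> 2"
  shows "s_m m q \<in> spin_bundle" "bundle_proj (s_m m q) = q"
proof -
  have "matrix_inv (f_m m q) \<in> SU11"
    unfolding matrix_inv_f_m[OF assms] using assms norm_zeta[OF assms]
    by (intro SU11_mult k_rotor_SU11 b_rotor_SU11) (simp_all add: norm_power)
  then show "s_m m q \<in> spin_bundle"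
    using f_m_SU11[OF assms] assms by (simp add: s_m_def spin_bundle_def SU11_mult SU11_dagger)
  show "bundle_proj (s_m m q) = q"
    using SU11_mult_inv[OF f_m_SU11[OF assms]]
    by (simp add: s_m_def bundle_proj_def matrix_mul_assoc[symmetric])
qed

section \<open>Smoothness of the extension\<close>

lemma bounded_linear_phase: "bounded_linear (phase m)"
  unfolding linear_conv_bounded_linear[symmetric]
  by (auto intro!: linearI simp: phase_def Let_def complex_eq_iff field_simps)

lemma open_phase_nonzero: "open {q. phase m q \<noteq> 0}"
  using bounded_linear.continuous_on[OF bounded_linear_phase continuous_on_id]
  by (intro open_Collect_neq continuous_on_const) auto

lemma Ck_on_zeta: "Ck_on k {q. phase m q \<noteq> 0} (zeta m)"
proof -
  let ?U = "{q. phase m q \<noteq> 0}"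
  \<comment> \<open>The squared norm is polynomial in \<open>q\<close>, so \<open>sgn\<close> can be
    written as its power -1/2 times the phase.\<close>
  let ?r = "\<lambda>q. Re (phase m q) * Re (phase m q) + Im (phase m q) * Im (phase m q)"
  note U = open_phase_nonzero[of m]
  have P: "Ck_on k ?U (phase m)"
    by (rule Ck_on_bounded_linear[OF U bounded_linear_phase Ck_on_id])
  have norm: "?r q = (norm (phase m q))\<^sup>2" for q
    by (simp add: cmod_def power2_eq_square)
  have "Ck_on k ?U ?r"
    by (intro Ck_on_add Ck_on_bounded_bilinear[OF _ bounded_bilinear_mult] U
        Ck_on_bounded_linear[OF _ bounded_linear_Re] Ck_on_bounded_linear[OF _ bounded_linear_Im] P)
  then have "Ck_on k ?U (\<lambda>q. ?r q powr (- (1/2)) *\<^sub>R phase m q)"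
    by (intro Ck_on_bounded_bilinear[OF U bounded_bilinear_scaleR] Ck_on_powr[OF U] P)
       (simp_all add: norm)
  moreover have "?r q powr (- (1/2)) *\<^sub>R phase m q = zeta m q" if "q \<in> ?U" for q
    unfolding norm using that by (simp add: sgn_div_norm powr_minus powr_half_sqrt inverse_eq_divide)
  ultimately show ?thesis
    using Ck_on_cong[OF U, of "\<lambda>q. ?r q powr (- (1/2)) *\<^sub>R phase m q" "zeta m"] by auto
qed

lemma Ck_on_power:
  fixes f :: "'a::euclidean_space \<Rightarrow> 'b::real_normed_algebra_1"
  assumes "open U" "Ck_on k U f"
  shows "Ck_on k U (\<lambda>x. f x ^ n)"
  by (induction n) (simp_all add: Ck_on_const assms Ck_on_bounded_bilinear[OF _ bounded_bilinear_mult])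

lemma Ck_on_Pair:
  assumes "open U" "Ck_on k U f" "Ck_on k U g"
  shows "Ck_on k U (\<lambda>x. (f x, g x))"
proof -
  have "Ck_on k U (\<lambda>x. (f x, 0) + (0, g x))"
    using assms by (intro Ck_on_add Ck_on_bounded_linear[where L = "\<lambda>y. (y, 0)"]
        Ck_on_bounded_linear[where L = "\<lambda>y. (0, y)"] bounded_linear_Pair bounded_linear_ident
        bounded_linear_zero)
  then show ?thesis by simp
qed

lemma smooth_on_s_ext: "smooth_on {q. phase m q \<noteq> 0} (s_ext m)"
  unfolding smooth_on_def s_ext_def
  by (intro allI Ck_on_Pair open_phase_nonzero Ck_on_id Ck_on_zeta Ck_on_power
      Ck_on_bounded_bilinear[OF _ bounded_bilinear_matrix_mult]
      Ck_on_bounded_linear[OF _ bounded_linear_dagger]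
      Ck_on_bounded_linear[OF _ bounded_linear_rotor] Ck_on_bounded_linear[OF _ bounded_linear_cnj])

lemma smooth_section_s_m:
  assumes "m \<ge> 2"
  shows "smooth_section (s_m m)"
  unfolding smooth_section_def smooth_map_def
  using s_m_section smooth_on_s_ext open_phase_nonzero phase_nonzero s_m_eq assms
  by (metis (mono_tags, lifting) Int_iff mem_Collect_eq)

section \<open>Derivatives along curves\<close>

text \<open>A local smooth extension shows that \<open>f\<close> is differentiable within
  \<open>M\<close>; the chain rule then holds for whichever derivative \<open>differential\<close>
  selects.\<close>

lemma differential_along_curve:
  assumes f: "smooth_map M f" and c: "c ` {-e<..<e} \<subseteq> M" "e > 0"
    and d: "(c has_vector_derivative v) (at (0::real))"
  shows "((\<lambda>t. f (c t)) has_vector_derivative differential M f (c 0) v) (at 0)"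
proof -
  have 0: "0 \<in> {-e<..<e}" using c(2) by simp
  with c have x: "c 0 \<in> M" by blast
  from f[unfolded smooth_map_def, rule_format, OF x] obtain U F
    where F: "open U" "c 0 \<in> U" "smooth_on U F" "\<forall>y\<in>M \<inter> U. F y = f y"
    by (elim exE conjE)
  obtain F' where "(F has_derivative F') (at (c 0))"
    using smooth_on_differentiable[OF F(3,2)] by (auto simp: differentiable_def)
  then have "(F has_derivative F') (at (c 0) within M)"
    by (rule has_derivative_at_withinI)
  moreover have "\<forall>\<^sub>F y in at (c 0) within M. F y = f y"
    using F by (auto simp: eventually_at_topological)
  moreover have "F (c 0) = f (c 0)" using F x by blast
  ultimately have "(f has_derivative F') (at (c 0) within M)"
    using x by (rule has_derivative_transform_eventually)
  then have "f differentiable (at (c 0) within M)"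
    by (rule differentiableI)
  then have "(f has_derivative differential M f (c 0)) (at (c 0) within M)"
    unfolding differential_def by (simp only: frechet_derivative_works)
  then have "(f has_derivative differential M f (c 0)) (at (c 0) within c ` {-e<..<e})"
    using c(1) by (rule has_derivative_subset)
  then have "(f \<circ> c has_vector_derivative differential M f (c 0) v) (at 0 within {-e<..<e})"
    by (rule vector_derivative_diff_chain_within[OF has_vector_derivative_at_within[OF d]])
  then show ?thesis using 0 by (simp add: at_within_open[OF 0] o_def)
qed

text \<open>Differentiating \<open>z t * cnj (z t) = 1\<close> shows that
  \<open>z' * cnj (z 0)\<close> is purely imaginary.\<close>

lemma has_vector_derivative_unit_circle:
  fixes z :: "real \<Rightarrow> complex"
  assumes "e > 0" "\<And>t. t \<in> {-e<..<e} \<Longrightarrow> norm (z t) = 1" "(z has_vector_derivative z') (at 0)"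
  shows "\<exists>\<tau>. z' = \<i> * of_real \<tau> * z 0"
proof -
  have 0: "0 \<in> {-e<..<e}" using assms(1) by simp
  have n: "z t * cnj (z t) = 1" if "t \<in> {-e<..<e}" for t
    using assms(2)[OF that] complex_norm_square[of "z t"] by simp
  have "((\<lambda>t. z t * cnj (z t)) has_vector_derivative (z 0 * cnj z' + z' * cnj (z 0))) (at 0)"
    by (intro has_vector_derivative_mult assms(3)
        bounded_linear.has_vector_derivative[OF bounded_linear_cnj])
  then have "((\<lambda>t. 1) has_vector_derivative (z 0 * cnj z' + z' * cnj (z 0))) (at 0)"
    by (rule has_vector_derivative_transform_within_open[OF _ open_greaterThanLessThan 0]) (simp add: n)
  then have "z 0 * cnj z' + z' * cnj (z 0) = 0"
    using vector_derivative_unique_at has_vector_derivative_const by blast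
  then have "Re (z' * cnj (z 0)) = 0"
    by (simp add: complex_eq_iff)
  then have "z' * cnj (z 0) = \<i> * of_real (Im (z' * cnj (z 0)))"
    by (simp add: complex_eq_iff)
  moreover have "z' = z' * cnj (z 0) * z 0"
    using n[OF 0] by (simp add: mult.assoc mult.commute)
  ultimately show ?thesis by metis
qed

text \<open>The orthogonality to \<open>lg ell\<close>, phrased by real row sums so that
  \<open>u\<close> and \<open>w\<close> need not be differentiated along the curve.\<close>

lemma trace_ell_curve:
  fixes a :: "real \<Rightarrow> cmat2"
  assumes e: "e > 0" and a: "a ` {-e<..<e} \<subseteq> SU11" and d: "(a has_vector_derivative a') (at 0)"
    and r: "\<And>t. t \<in> {-e<..<e} \<Longrightarrow> Im (a t $ 1 $ 1 + a t $ 1 $ 2) = 0"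
  shows "trace (lg ell ** (matrix_inv (a 0) ** a')) = 0"
proof -
  have 0: "0 \<in> {-e<..<e}" using e by simp
  have S: "a 0 \<in> SU11" using a 0 by blast
  define M where "M = matrix_inv (a 0) ** a'"
  have M: "M \<in> su11" unfolding M_def by (rule SU11_curve_derivative[OF e a d])
  have L: "bounded_linear (\<lambda>A::cmat2. Im (A $ 1 $ 1 + A $ 1 $ 2))"
    by (intro bounded_linear_compose[OF bounded_linear_Im] bounded_linear_add bounded_linear_cmat2_nth)
  have "((\<lambda>t. 0) has_vector_derivative Im (a' $ 1 $ 1 + a' $ 1 $ 2)) (at 0)"
    by (rule has_vector_derivative_transform_within_open[OF
          bounded_linear.has_vector_derivative[OF L d] open_greaterThanLessThan 0]) (rule r)
  then have r': "Im (a' $ 1 $ 1 + a' $ 1 $ 2) = 0"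
    using vector_derivative_unique_at has_vector_derivative_const by blast
  have a': "a' = a 0 ** M"
    by (simp add: M_def matrix_mul_assoc SU11_mult_inv[OF S])
  have M2: "M $ 2 $ 1 = cnj (M $ 1 $ 2)" "M $ 2 $ 2 = cnj (M $ 1 $ 1)"
    using M by (simp_all add: su11_iff complex_eq_iff)
  have i: "Im (a 0 $ 1 $ 2) = - Im (a 0 $ 1 $ 1)"
    using r[OF 0] by simp
  have "(Re (a 0 $ 1 $ 1) - Re (a 0 $ 1 $ 2)) * (Im (M $ 1 $ 1) + Im (M $ 1 $ 2)) = 0"
    using r' by (simp add: a' cmat2_mult_nth M2 i algebra_simps)
  \<comment> \<open>The imaginary parts of the row are opposite, so the condition says that the
    squares of the real parts differ by 1; hence the factor above is nonzero.\<close>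
  moreover have "Re (a 0 $ 1 $ 1 * cnj (a 0 $ 1 $ 1) - a 0 $ 1 $ 2 * cnj (a 0 $ 1 $ 2)) = 1"
    using SU11_entries(3)[OF S] by simp
  then have "Re (a 0 $ 1 $ 1) - Re (a 0 $ 1 $ 2) \<noteq> 0"
    by (auto simp: i)
  ultimately have "Im (M $ 1 $ 1) + Im (M $ 1 $ 2) = 0"
    by simp
  moreover have "trace (lg ell ** M) = of_real (Im (M $ 1 $ 1) + Im (M $ 1 $ 2))"
    using M by (simp add: su11_iff trace_def sum_2 cmat2_mult_nth lg_nth ell_def X0_def X1_def
        axis_def complex_eq_iff)
  ultimately show ?thesis by (simp add: M_def)
qed

section \<open>Vanishing of the pullback\<close>

lemma matrix_mult_add_rdistrib: "(A + B) ** C = A ** C + B ** C"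
  for A B C :: "'a::semiring_1^'n^'n"
  by (simp add: matrix_matrix_mult_def vec_eq_iff sum.distrib distrib_right)

lemma matrix_cancel:
  fixes A B C :: "'a::semiring_1^'n^'n"
  assumes "A ** B = mat 1"
  shows "A ** (B ** C) = C"
  by (simp add: matrix_mul_assoc assms)

lemma conjugate_left_logarithmic_derivative:
  fixes A A' Ai B Bi N :: "'a::comm_ring_1^'n^'n"
  assumes "Ai ** A = mat 1"
  shows "B ** Ai ** (A ** (N ** Bi) + A' ** Bi) = B ** (Ai ** A' + N) ** Bi"
  by (simp add: matrix_add_ldistrib matrix_mult_add_rdistrib matrix_mul_assoc[symmetric]
      matrix_cancel[OF assms] add.commute)

text \<open>The adjoint in the second component of the section turns its left logarithmic derivative
  into the right one of \<open>B ** Ki\<close>.\<close>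

lemma conjugate_right_logarithmic_derivative:
  fixes B Bi K Ki N N' :: "'a::comm_ring_1^'n^'n"
  assumes "Ki ** K = mat 1"
  shows "(B ** (N ** Ki) + B ** N' ** Ki) ** (K ** Bi) = B ** (N' + N) ** Bi"
  by (simp add: matrix_add_ldistrib matrix_mult_add_rdistrib matrix_mul_assoc[symmetric]
      matrix_cancel[OF assms] add.commute)

text \<open>Expanding the half sums and half differences, the products \<open>A ** A'\<close> and
  \<open>B ** B'\<close> cancel and only the mixed terms survive.\<close>

lemma Omega_eq_trace:
  assumes "omega_L p \<xi> = A" "dagger (omega_R p \<xi>) = B" "A \<in> su11" "B \<in> su11"
    and "omega_L p \<eta> = A'" "dagger (omega_R p \<eta>) = B'" "A' \<in> su11" "B' \<in> su11"
  shows "Omega p \<xi> \<eta> = Re (trace (B ** A')) - Re (trace (A ** B'))"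
proof -
  have su: "(1/2) *\<^sub>R (C + D) \<in> su11" "(1/2) *\<^sub>R (C - D) \<in> su11" if "C \<in> su11" "D \<in> su11" for C D
    using that subspace_su11 by (simp_all add: subspace_add subspace_diff subspace_scale)
  show ?thesis
    using assms
    by (simp add: Omega_def solder_form_def spin_connection_def mink_inner_lg_inv su)
       (simp add: trace_def sum_2 cmat2_mult_nth field_simps)
qed

text \<open>The formulas of the overview at one tangent vector: \<open>M\<close> is the value of the
  logarithmic derivative of the \<open>a\<close>-factor, and \<open>\<sigma>\<close> that of
  \<open>dv\<close>.\<close>

lemma Maurer_Cartan_s_m:
  assumes m: "m \<ge> 2" and q: "q \<in> SU11" and v: "v \<in> tangent_space SU11 q"
  defines "b \<equiv> b_rotor m (zeta m q ^ m)" and "\<xi> \<equiv> differential SU11 (s_m m) q v"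
  obtains M \<sigma> where "M \<in> su11" "trace (lg ell ** M) = 0"
    "omega_L (s_m m q) \<xi> = b ** (M - (2 * \<sigma>) *\<^sub>R lg (Y_m m)) ** matrix_inv b"
    "dagger (omega_R (s_m m q) \<xi>) = b ** ((2 * \<sigma> / 3) *\<^sub>R lg ell) ** matrix_inv b"
proof -
  obtain c e where e: "e > 0" and c: "c ` {-e<..<e} \<subseteq> SU11" and c0: "c 0 = q"
    and dc: "(c has_vector_derivative v) (at (0::real))"
    using v unfolding tangent_space_def by blast
  have 0: "0 \<in> {-e<..<e}" using e by simp
  have S: "c t \<in> SU11" if "t \<in> {-e<..<e}" for t using c that by blast
  let ?I = "{-e<..<e}"
  have d\<xi>: "((\<lambda>t. s_m m (c t)) has_vector_derivative \<xi>) (at 0)"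
    using differential_along_curve[OF _ c e dc, of "s_m m"] smooth_section_s_m[OF m]
    by (simp add: \<xi>_def c0 smooth_section_def)
  define z where "z t = zeta m (c t)" for t
  have nz: "norm (z t) = 1" if "t \<in> ?I" for t
    unfolding z_def by (rule norm_zeta[OF S[OF that] m])
  have z0: "z 0 = zeta m q" by (simp add: z_def c0)
  have "zeta m differentiable (at (c 0))"
    using Ck_on_zeta[of "Suc 0" m] phase_nonzero[OF q m] by (simp add: c0)
  then obtain D where "(zeta m has_derivative D) (at (c 0))"
    by (auto simp: differentiable_def)
  then have "(zeta m \<circ> c has_vector_derivative D v) (at 0)"
    by (rule vector_derivative_diff_chain_within[OF dc has_derivative_at_withinI])
  then have "(z has_vector_derivative D v) (at 0)"
    by (simp add: z_def[abs_def] o_def)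
  moreover from has_vector_derivative_unit_circle[OF e nz this]
  obtain \<tau> where "D v = \<i> * of_real \<tau> * z 0" by auto
  ultimately have dz: "(z has_vector_derivative (\<i> * of_real \<tau> * z 0)) (at 0)" by simp
  have "((\<lambda>t. z t ^ m) has_vector_derivative (of_nat m * (\<i> * of_real \<tau> * z 0) * z 0 ^ (m - 1))) (at 0)"
    using has_derivative_power[OF dz[unfolded has_vector_derivative_def], of m]
    by (simp add: has_vector_derivative_def mult_ac scaleR_conv_of_real)
  moreover have "of_nat m * (\<i> * of_real \<tau> * z 0) * z 0 ^ (m - 1) = \<i> * of_real (m * \<tau>) * z 0 ^ m"
    using m by (simp add: power_eq_if)
  ultimately have dw: "((\<lambda>t. z t ^ m) has_vector_derivative (\<i> * of_real (m * \<tau>) * z 0 ^ m)) (at 0)"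
    by (simp only:)
  \<comment> \<open>Since \<open>z\<close> stands for \<open>cis (omega_m m * v)\<close>, its
    angular velocity \<open>\<tau>\<close> is \<open>omega_m m\<close> times that of
    \<open>v\<close>.\<close>
  define \<sigma> where "\<sigma> = \<tau> / omega_m m"
  have mw: "omega_m m \<noteq> 0" "real m * omega_m m \<noteq> 0" using omega_m_pos[OF m] m by auto
  note k_mult = rotor_mult[OF mink_inner_Z_m mw(1)] and b_mult = rotor_mult[OF mink_inner_Y_m[OF m] mw(2)]
  let ?k = "k_rotor m (z 0)" and ?k' = "k_rotor m (cnj (z 0))" and ?b' = "b_rotor m (cnj (z 0 ^ m))"
  let ?Y = "(2 * \<sigma>) *\<^sub>R lg (Y_m m)" and ?Z = "(2 * \<sigma>) *\<^sub>R lg (Z_m m)"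
  have bz: "b = b_rotor m (z 0 ^ m)" by (simp add: b_def z0)
  have nw: "norm (z 0 ^ m) = 1" using nz[OF 0] by (simp add: norm_power)
  have b': "matrix_inv b = ?b'" "b \<in> SU11"
    unfolding bz by (rule matrix_inv_b_rotor[OF m nw], rule b_rotor_SU11[OF m nw])
  have inv: "b ** ?b' = mat 1" "?b' ** b = mat 1" "?k ** ?k' = mat 1" "?k' ** ?k = mat 1"
    unfolding bz using rotor_mult_cnj[OF mink_inner_Y_m[OF m] mw(2) nw]
      rotor_mult_cnj[OF mink_inner_Z_m mw(1) nz[OF 0]] by simp_all
  \<comment> \<open>The factor \<open>m\<close> from the power cancels against the frequency of
    \<open>b_rotor\<close>, so \<open>Y_m\<close> and \<open>Z_m\<close> get the same
    coefficient.\<close>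
  have gen: "b_rotor m (\<i> * of_real (m * \<tau>)) = ?Y" "k_rotor m (\<i> * of_real \<tau>) = ?Z"
    "b_rotor m (\<i> * of_real (- (m * \<tau>))) = - ?Y" "k_rotor m (\<i> * of_real (- \<tau>)) = - ?Z"
    unfolding rotor_imaginary \<sigma>_def using mw m by simp_all
  have db: "b_rotor m (\<i> * of_real (m * \<tau>) * z 0 ^ m) = b ** ?Y"
    unfolding bz gen(1)[symmetric] b_mult by (simp add: mult.commute)
  have db': "b_rotor m (cnj (\<i> * of_real (m * \<tau>) * z 0 ^ m)) = - ?Y ** ?b'"
    unfolding gen(3)[symmetric] b_mult by simp
  have dk': "k_rotor m (cnj (\<i> * of_real \<tau> * z 0)) = - ?Z ** ?k'"
    unfolding gen(4)[symmetric] k_mult by simp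

  \<comment> \<open>The \<open>a\<close>-factor of the decomposition, recovered from
    \<open>c\<close> without choosing \<open>u\<close>, \<open>w\<close> and
    \<open>v\<close>.\<close>
  define a where "a t = c t ** k_rotor m (z t)" for t
  define a' where "a' = c 0 ** k_rotor m (\<i> * of_real \<tau> * z 0) + v ** k_rotor m (z 0)"
  have da: "(a has_vector_derivative a') (at 0)"
    unfolding a_def[abs_def] a'_def
    by (intro bounded_bilinear.has_vector_derivative[OF bounded_bilinear_matrix_mult] dc
        bounded_linear.has_vector_derivative[OF bounded_linear_rotor] dz)
  have aS: "a ` ?I \<subseteq> SU11"
    using S nz m by (auto simp: a_def intro!: SU11_mult k_rotor_SU11)
  have ar: "Im (a t $ 1 $ 1 + a t $ 1 $ 2) = 0" if "t \<in> ?I" for t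
    using row_sum_zeta[OF S[OF that] m] by (simp add: a_def z_def)
  define M where "M = matrix_inv (a 0) ** a'"
  have a0: "a 0 \<in> SU11" using aS 0 by blast

  have s: "s_m m (c t) = (a t ** b_rotor m (cnj (z t ^ m)),
      dagger (b_rotor m (z t ^ m) ** k_rotor m (cnj (z t))))" if "t \<in> ?I" for t
    unfolding s_m_eq[OF S[OF that] m] s_ext_def a_def z_def ..
  have s0: "s_m m q = (a 0 ** ?b', dagger (b ** ?k'))"
    using s[OF 0] by (simp add: c0 bz)

  \<comment> \<open>Each component of \<open>\<xi>\<close> is found by differentiating it twice, by
    the product rule and as a projection of the section along \<open>c\<close>.\<close>
  have "((\<lambda>t. a t ** b_rotor m (cnj (z t ^ m))) has_vector_derivative
      (a 0 ** (- ?Y ** ?b') + a' ** ?b')) (at 0)"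
    unfolding db'[symmetric]
    by (intro bounded_bilinear.has_vector_derivative[OF bounded_bilinear_matrix_mult] da
        bounded_linear.has_vector_derivative[OF bounded_linear_rotor]
        bounded_linear.has_vector_derivative[OF bounded_linear_cnj] dw)
  moreover have "((\<lambda>t. a t ** b_rotor m (cnj (z t ^ m))) has_vector_derivative fst \<xi>) (at 0)"
    by (rule has_vector_derivative_transform_within_open[OF
          bounded_linear.has_vector_derivative[OF bounded_linear_fst d\<xi>] open_greaterThanLessThan 0])
      (simp add: s)
  ultimately have \<xi>1: "fst \<xi> = a 0 ** (- ?Y ** ?b') + a' ** ?b'"
    using vector_derivative_unique_at by blast
  have "((\<lambda>t. dagger (b_rotor m (z t ^ m) ** k_rotor m (cnj (z t)))) has_vector_derivative
      dagger (b ** (- ?Z ** ?k') + (b ** ?Y) ** ?k')) (at 0)"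
    unfolding db[symmetric] dk'[symmetric] unfolding bz
    by (intro bounded_linear.has_vector_derivative[OF bounded_linear_dagger]
        bounded_bilinear.has_vector_derivative[OF bounded_bilinear_matrix_mult]
        bounded_linear.has_vector_derivative[OF bounded_linear_rotor]
        bounded_linear.has_vector_derivative[OF bounded_linear_cnj] dw dz)
  moreover have "((\<lambda>t. dagger (b_rotor m (z t ^ m) ** k_rotor m (cnj (z t)))) has_vector_derivative
      snd \<xi>) (at 0)"
    by (rule has_vector_derivative_transform_within_open[OF
          bounded_linear.has_vector_derivative[OF bounded_linear_snd d\<xi>] open_greaterThanLessThan 0])
      (simp add: s)
  ultimately have \<xi>2: "snd \<xi> = dagger (b ** (- ?Z ** ?k') + (b ** ?Y) ** ?k')"
    using vector_derivative_unique_at by blast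

  have "(a 0 ** ?b') ** (b ** matrix_inv (a 0)) = mat 1"
    by (simp only: matrix_mul_assoc[symmetric] matrix_cancel[OF inv(2)] SU11_mult_inv(1)[OF a0])
  then have "matrix_inv (a 0 ** ?b') = b ** matrix_inv (a 0)"
    by (rule matrix_inv_eqI)
  then have "omega_L (s_m m q) \<xi> = b ** matrix_inv (a 0) ** (a 0 ** (- ?Y ** ?b') + a' ** ?b')"
    by (simp only: omega_L_def s0 fst_conv \<xi>1)
  also have "\<dots> = b ** (M + - ?Y) ** ?b'"
    unfolding M_def by (rule conjugate_left_logarithmic_derivative[OF SU11_mult_inv(2)[OF a0]])
  finally have 1: "omega_L (s_m m q) \<xi> = b ** (M - ?Y) ** matrix_inv b"
    unfolding b' add_uminus_conv_diff .

  have "(?k ** ?b') ** (b ** ?k') = mat 1"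
    by (simp only: matrix_mul_assoc[symmetric] matrix_cancel[OF inv(2)] inv(3))
  then have "dagger (b ** ?k') ** dagger (?k ** ?b') = mat 1"
    unfolding dagger_mult[symmetric] by (simp add: cmat2_eq_iff)
  then have "matrix_inv (dagger (b ** ?k')) = dagger (?k ** ?b')"
    by (rule matrix_inv_eqI)
  then have "dagger (omega_R (s_m m q) \<xi>) = (b ** (- ?Z ** ?k') + b ** ?Y ** ?k') ** (?k ** ?b')"
    by (simp only: omega_R_def s0 snd_conv \<xi>2 dagger_mult[of "dagger _" "dagger _"] dagger_dagger)
  also have "\<dots> = b ** (?Y + - ?Z) ** ?b'"
    by (rule conjugate_right_logarithmic_derivative[OF inv(4)])
  also have "?Y + - ?Z = (2 * \<sigma> / 3) *\<^sub>R lg ell"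
    using Y_m_minus_Z_m[of m] by (simp add: scaleR_diff_right[symmetric])
  finally have 2: "dagger (omega_R (s_m m q) \<xi>) = b ** ((2 * \<sigma> / 3) *\<^sub>R lg ell) ** matrix_inv b"
    unfolding b' .
  show ?thesis
    using that[OF _ _ 1 2] SU11_curve_derivative[OF e aS da] trace_ell_curve[OF e aS da ar]
    by (simp add: M_def)
qed

theorem proposition3p6:
  fixes m :: nat
  assumes "m \<ge> 2"
  shows "Omega_Lagrangian_section (s_m m)"
  unfolding Omega_Lagrangian_section_def
proof (intro conjI ballI)
  show "smooth_section (s_m m)" by (rule smooth_section_s_m[OF assms])
  fix q v v'
  assume q: "q \<in> SU11" and v: "v \<in> tangent_space SU11 q" and v': "v' \<in> tangent_space SU11 q"
  let ?b = "b_rotor m (zeta m q ^ m)" and ?Y = "lg (Y_m m)"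
  let ?\<xi> = "differential SU11 (s_m m) q v" and ?\<eta> = "differential SU11 (s_m m) q v'"
  obtain M s where M: "M \<in> su11" "trace (lg ell ** M) = 0"
    "omega_L (s_m m q) ?\<xi> = ?b ** (M - (2 * s) *\<^sub>R ?Y) ** matrix_inv ?b"
    "dagger (omega_R (s_m m q) ?\<xi>) = ?b ** ((2 * s / 3) *\<^sub>R lg ell) ** matrix_inv ?b"
    by (rule Maurer_Cartan_s_m[OF assms q v])
  obtain M' s' where M': "M' \<in> su11" "trace (lg ell ** M') = 0"
    "omega_L (s_m m q) ?\<eta> = ?b ** (M' - (2 * s') *\<^sub>R ?Y) ** matrix_inv ?b"
    "dagger (omega_R (s_m m q) ?\<eta>) = ?b ** ((2 * s' / 3) *\<^sub>R lg ell) ** matrix_inv ?b"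
    by (rule Maurer_Cartan_s_m[OF assms q v'])
  have b: "?b \<in> SU11"
    using norm_zeta[OF q assms] by (intro b_rotor_SU11[OF assms]) (simp add: norm_power)
  have lg: "lg X \<in> su11" for X using lg_bij by (auto simp: bij_betw_def)
  have su: "N - r *\<^sub>R ?Y \<in> su11" "r *\<^sub>R lg ell \<in> su11" if "N \<in> su11" for N r
    using that lg subspace_su11 by (simp_all add: subspace_diff subspace_scale)
  have tr: "trace ((?b ** A ** matrix_inv ?b) ** (?b ** B ** matrix_inv ?b)) = trace (A ** B)" for A B
  proof -
    have "(?b ** A ** matrix_inv ?b) ** (?b ** B ** matrix_inv ?b) = ?b ** (A ** B) ** matrix_inv ?b"
      by (simp only: matrix_mul_assoc[symmetric] matrix_cancel[OF SU11_mult_inv(2)[OF b]])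
    then show ?thesis by (simp only: trace_conjugate[OF SU11_mult_inv(2)[OF b]])
  qed
  \<comment> \<open>The summand \<open>N\<close> is orthogonal to \<open>lg ell\<close>, so only the
    \<open>Y_m\<close> term remains, with a coefficient symmetric in \<open>r\<close> and
    \<open>t\<close>.\<close>
  have ell: "trace ((r *\<^sub>R lg ell) ** (N - t *\<^sub>R ?Y)) = - of_real (r * t) * trace (lg ell ** ?Y)"
    if "trace (lg ell ** N) = 0" for r t N
  proof -
    have "trace ((r *\<^sub>R lg ell) ** (N - t *\<^sub>R ?Y)) =
        of_real r * trace (lg ell ** N) - of_real (r * t) * trace (lg ell ** ?Y)"
      by (simp add: trace_def sum_2 cmat2_mult_nth) (simp add: scaleR_conv_of_real algebra_simps)
    with that show ?thesis by simp
  qed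
  \<comment> \<open>Both traces equal \<open>- (4 * s * s' / 3)\<close> times the trace of
    \<open>lg ell ** ?Y\<close>, so their difference vanishes.\<close>
  have "Omega (s_m m q) ?\<xi> ?\<eta> = 0"
    using M(1) M'(1)
    by (subst Omega_eq_trace[OF M(3,4) _ _ M'(3,4)])
      (simp_all add: su su11_conjugate[OF b] tr ell[OF M'(2)]
        trace_mul_sym[of "M - (2 * s) *\<^sub>R ?Y"] ell[OF M(2)])
  then show "pullback2 SU11 (s_m m) Omega q v v' = 0"
    by (simp add: pullback2_def)
qed

end
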